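(* Let $k$ be a field and let $(R,<)$ be a totally ordered set which has a countable subset that is dense in the order topology on $R$. Let $V$ be a persistence module over $k$ indexed by $R$ which has the descending chain condition on images and kernels, and let $I\subseteq R$ be an interval. Then the multiplicity of the interval module $k_I$ as a summand of $V$ is equal to the dimension of the vector space $V^+_I/V^-_I$.
   Context: A persistence module $V$ (over $k$, indexed by $R$) is a functor from $R$, viewed as a category via its order, to $k$-vector spaces: it consists of $k$-vector spaces $V_t$ for $t\in R$ and linear maps $\rho_{ts}:V_s\to V_t$ for $s\le t$, with $\rho_{ts}\rho_{sr}=\rho_{tr}$ for all $r\le s\le t$ and $\rho_{tt}=1_{V_t}$ for all $t$. $V$ has the descending chain condition on images and kernels if for all $t,s_1,s_2,\ldots\in R$ with $t\ge s_1>s_2>\cdots$ the chain $V_t\supseteq \operatorname{Im}\rho_{ts_1}\supseteq \operatorname{Im}\rho_{ts_2}\supseteq\cdots$ stabilizes, and for all $t,r_1,r_2,\ldots\in R$ with $t\le\cdots<r_2<r_1$ the chain $V_t\supseteq \operatorname{Ker}\rho_{r_1t}\supseteq \operatorname{Ker}\rho_{r_2t}\supseteq\cdots$ stabilizes. A subset $I\subseteq R$ is an interval if it is non-empty and $r\le s\le t$ with $r,t\in I$ implies $s\in I$. The interval module $k_I$ has $V_t=k$ for $t\in I$, $V_t=0$ for $t\notin I$, and $\rho_{ts}=1$ for $s,t\in I$ with $s\le t$ (all other $\rho_{ts}$ being zero). Such a $V$ is a direct sum of interval modules, and the multiplicity of $k_I$ as a summand of $V$ is the number (cardinality) of summands isomorphic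 to $k_I$ in a decomposition of $V$ as a direct sum of interval modules; by the Krull-Remak-Schmidt-Azumaya theorem it is uniquely determined. A cut for $R$ is a pair $c=(c^-,c^+)$ of subsets of $R$ (possibly empty) such that $R=c^-\cup c^+$ and $s<t$ for all $s\in c^-$, $t\in c^+$. If $t\in c^+$, define subspaces of $V_t$ by $\operatorname{Im}^-_{ct}=\bigcup_{s\in c^-}\operatorname{Im}\rho_{ts}$ and $\operatorname{Im}^+_{ct}=\bigcap_{s\in c^+,\,s\le t}\operatorname{Im}\rho_{ts}$. If $t\in c^-$, define $\operatorname{Ker}^-_{ct}=\bigcup_{r\in c^-,\,t\le r}\operatorname{Ker}\rho_{rt}$ and $\operatorname{Ker}^+_{ct}=\bigcap_{r\in c^+}\operatorname{Ker}\rho_{rt}$. By convention $\operatorname{Im}^-_{ct}=0$ if $c^-=\emptyset$ and $\operatorname{Ker}^+_{ct}=V_t$ if $c^+=\emptyset$. For an interval $I$ there are unique cuts $\ell$ and $u$ with $I=\ell^+\cap u^-$, namely $\ell^-=\{t: t<s \text{ for all } s\in I\}$, $\ell^+=\{t: t\ge s\text{ for some }s\in I\}$, $u^+=\{t: t>s\text{ for all }s\in I\}$, $u^-=\{t: t\le s\text{ for some }s\in I\}$. For $t\in I$ define $$V^-_{It}=(\operatorname{Im}^-_{\ell t}\cap \operatorname{Ker}^+_{ut})+(\operatorname{Im}^+_{\ell t}\cap\operatorname{Ker}^-_{ut}),\qquad V^+_{It}=\operatorname{Im}^+_{\ell t}\cap\operatorname{Ker}^+_{ut}.$$ For $s\le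 t$ in $I$, $\rho_{ts}$ maps $V^\pm_{Is}$ into $V^\pm_{It}$, and $V^\pm_I=\varprojlim_{t\in I}V^\pm_{It}$ is the inverse limit with respect to these maps. With $\pi_t:V^+_I\to V^+_{It}$ the natural map, $V^-_I$ is identified with the subspace $\bigcap_{t\in I}\pi_t^{-1}(V^-_{It})$ of $V^+_I$. *)

theory Defs
  imports
    "HOL-Analysis.Elementary_Topology"
    "HOL-Library.Function_Algebras"
    "HOL-Library.Set_Algebras"
begin

unbundle cardinal_syntax
no_notation (input) elt_set_eq (infix \<open>=o\<close> 50)

section \<open>Persistence modules\<close>

definition linear_between ::
    "('k \<Rightarrow> 'v \<Rightarrow> 'v) \<Rightarrow> 'v::plus set \<Rightarrow> ('k \<Rightarrow> 'w \<Rightarrow> 'w) \<Rightarrow> 'w::plus set \<Rightarrow> ('v \<Rightarrow> 'w) \<Rightarrow> bool" where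
  "linear_between s1 U s2 W f \<longleftrightarrow>
     f ` U \<subseteq> W \<and>
     (\<forall>x\<in>U. \<forall>y\<in>U. f (x + y) = f x + f y) \<and>
     (\<forall>c. \<forall>x\<in>U. f (s1 c x) = s2 c (f x))"

text \<open>The spaces \<open>V t\<close> are subspaces of one ambient vector space. This is no restriction:
  any family of vector spaces embeds into its direct sum. The map \<open>\<rho> t s\<close> goes from \<open>V s\<close> to
  \<open>V t\<close>; its values off \<open>V s\<close>, or for \<open>s > t\<close>, are irrelevant.\<close>

locale persistence_module = vector_space scale
  for scale :: "'k::field \<Rightarrow> 'v::ab_group_add \<Rightarrow> 'v" +
  fixes V :: "'r::linorder \<Rightarrow> 'v set"
    and \<rho> :: "'r \<Rightarrow> 'r \<Rightarrow> 'v \<Rightarrow> 'v"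
  assumes subspace_V: "subspace (V t)"
    and linear_\<rho>: "s \<le> t \<Longrightarrow> linear_between scale (V s) scale (V t) (\<rho> t s)"
    and \<rho>_comp: "r \<le> s \<Longrightarrow> s \<le> t \<Longrightarrow> x \<in> V r \<Longrightarrow> \<rho> t s (\<rho> s r x) = \<rho> t r x"
    and \<rho>_id: "x \<in> V t \<Longrightarrow> \<rho> t t x = x"

definition Im :: "('r \<Rightarrow> 'v set) \<Rightarrow> ('r \<Rightarrow> 'r \<Rightarrow> 'v \<Rightarrow> 'v) \<Rightarrow> 'r \<Rightarrow> 'r \<Rightarrow> 'v set" where
  "Im V \<rho> t s = \<rho> t s ` V s"

definition Ker :: "('r \<Rightarrow> 'v::zero set) \<Rightarrow> ('r \<Rightarrow> 'r \<Rightarrow> 'v \<Rightarrow> 'v) \<Rightarrow> 'r \<Rightarrow> 'r \<Rightarrow> 'v set" where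
  "Ker V \<rho> r t = {x \<in> V t. \<rho> r t x = 0}"

definition dcc_images_kernels ::
    "('r::linorder \<Rightarrow> 'v::zero set) \<Rightarrow> ('r \<Rightarrow> 'r \<Rightarrow> 'v \<Rightarrow> 'v) \<Rightarrow> bool" where
  "dcc_images_kernels V \<rho> \<longleftrightarrow>
     (\<forall>t (s :: nat \<Rightarrow> 'r). s 0 \<le> t \<and> (\<forall>n. s (Suc n) < s n) \<longrightarrow>
        (\<exists>N. \<forall>n\<ge>N. Im V \<rho> t (s n) = Im V \<rho> t (s N))) \<and>
     (\<forall>t (r :: nat \<Rightarrow> 'r). (\<forall>n. t \<le> r n) \<and> (\<forall>n. r (Suc n) < r n) \<longrightarrow>
        (\<exists>N. \<forall>n\<ge>N. Ker V \<rho> (r n) t = Ker V \<rho> (r N) t))"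

definition pmod_iso ::
    "('k \<Rightarrow> 'v \<Rightarrow> 'v) \<Rightarrow> ('r::linorder \<Rightarrow> 'v::plus set) \<Rightarrow> ('r \<Rightarrow> 'r \<Rightarrow> 'v \<Rightarrow> 'v) \<Rightarrow>
     ('k \<Rightarrow> 'w \<Rightarrow> 'w) \<Rightarrow> ('r \<Rightarrow> 'w::plus set) \<Rightarrow> ('r \<Rightarrow> 'r \<Rightarrow> 'w \<Rightarrow> 'w) \<Rightarrow> bool" where
  "pmod_iso s1 V \<rho> s2 W \<sigma> \<longleftrightarrow>
     (\<exists>f. (\<forall>t. linear_between s1 (V t) s2 (W t) (f t) \<and> bij_betw (f t) (V t) (W t)) \<and>
          (\<forall>s t. s \<le> t \<longrightarrow> (\<forall>x\<in>V s. f t (\<rho> t s x) = \<sigma> t s (f s x))))"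

section \<open>Interval modules and multiplicities\<close>

definition order_interval :: "'r::linorder set \<Rightarrow> bool" where
  "order_interval I \<longleftrightarrow> I \<noteq> {} \<and> (\<forall>r\<in>I. \<forall>t\<in>I. \<forall>s. r \<le> s \<and> s \<le> t \<longrightarrow> s \<in> I)"

text \<open>The interval module \<open>k\<^sub>I\<close>, inside the field regarded as a vector space over itself.\<close>

definition interval_space :: "'r set \<Rightarrow> 'r \<Rightarrow> 'k::field set" where
  "interval_space I t = (if t \<in> I then UNIV else {0})"

definition interval_map :: "'r set \<Rightarrow> 'r \<Rightarrow> 'r \<Rightarrow> 'k \<Rightarrow> 'k::field" where
  "interval_map I t s x = (if s \<in> I \<and> t \<in> I then x else 0)"

lemma persistence_module_interval:
  assumes "order_interval I"
  shows "persistence_module ((*) :: 'k::field \<Rightarrow> 'k \<Rightarrow> 'k) (interval_space I) (interval_map I)"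
proof -
  have vs: "vector_space ((*) :: 'k \<Rightarrow> 'k \<Rightarrow> 'k)"
    by (rule vector_space.intro) (simp_all add: distrib_left distrib_right mult.assoc)
  then have mod: "module ((*) :: 'k \<Rightarrow> 'k \<Rightarrow> 'k)"
    by (simp add: module_iff_vector_space)
  show ?thesis
  proof (intro persistence_module.intro persistence_module_axioms.intro vs)
    show "module.subspace (*) (interval_space I t :: 'k set)" for t
      by (simp add: module.subspace_def[OF mod] interval_space_def)
    show "linear_between (*) (interval_space I s) (*) (interval_space I t)
        (interval_map I t s :: 'k \<Rightarrow> 'k)" for s t
      by (simp add: linear_between_def interval_space_def interval_map_def image_subset_iff)
    show "interval_map I t s (interval_map I s r x) = interval_map I t r x"
      if "r \<le> s" "s \<le> t" for r s t and x :: 'k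
    proof (cases "r \<in> I \<and> t \<in> I")
      case True
      then have "s \<in> I"
        using assms that unfolding order_interval_def by blast
      with True show ?thesis by (simp add: interval_map_def)
    next
      case False
      then show ?thesis by (simp add: interval_map_def)
    qed
    show "interval_map I t t x = x" if "x \<in> interval_space I t" for t and x :: 'k
      using that by (simp add: interval_space_def interval_map_def split: if_splits)
  qed
qed

definition iso_interval_module ::
    "('k::field \<Rightarrow> 'v \<Rightarrow> 'v) \<Rightarrow> ('r::linorder \<Rightarrow> 'v::plus set) \<Rightarrow> ('r \<Rightarrow> 'r \<Rightarrow> 'v \<Rightarrow> 'v) \<Rightarrow>
     'r set \<Rightarrow> bool" where
  "iso_interval_module scl V \<rho> I \<longleftrightarrow>
     pmod_iso scl V \<rho> (*) (interval_space I) (interval_map I)"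

definition pmod_submodule ::
    "('k::field \<Rightarrow> 'v \<Rightarrow> 'v) \<Rightarrow> ('r::linorder \<Rightarrow> 'v::ab_group_add set) \<Rightarrow>
     ('r \<Rightarrow> 'r \<Rightarrow> 'v \<Rightarrow> 'v) \<Rightarrow> ('r \<Rightarrow> 'v set) \<Rightarrow> bool" where
  "pmod_submodule scl V \<rho> M \<longleftrightarrow>
     (\<forall>t. module.subspace scl (M t) \<and> M t \<subseteq> V t) \<and>
     (\<forall>s t. s \<le> t \<longrightarrow> \<rho> t s ` M s \<subseteq> M t)"

text \<open>Pointwise external direct sum of a set of submodules: families of finite support.\<close>

definition direct_sum_at :: "('r \<Rightarrow> 'v::zero set) set \<Rightarrow> 'r \<Rightarrow> (('r \<Rightarrow> 'v set) \<Rightarrow> 'v) set" where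
  "direct_sum_at D t =
     {x. (\<forall>M\<in>D. x M \<in> M t) \<and> (\<forall>M. M \<notin> D \<longrightarrow> x M = 0) \<and> finite {M. x M \<noteq> 0}}"

text \<open>\<open>V\<close> is the internal direct sum of the submodules in \<open>D\<close>, each isomorphic to an interval
  module. Summands can be collected in a set rather than an indexed family, since interval
  modules are nonzero and so no submodule can occur twice in an internal direct sum.\<close>

definition interval_decomposition ::
    "('k::field \<Rightarrow> 'v \<Rightarrow> 'v) \<Rightarrow> ('r::linorder \<Rightarrow> 'v::ab_group_add set) \<Rightarrow>
     ('r \<Rightarrow> 'r \<Rightarrow> 'v \<Rightarrow> 'v) \<Rightarrow> ('r \<Rightarrow> 'v set) set \<Rightarrow> bool" where
  "interval_decomposition scl V \<rho> D \<longleftrightarrow>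
     (\<forall>M\<in>D. pmod_submodule scl V \<rho> M \<and>
             (\<exists>J. order_interval J \<and> iso_interval_module scl M \<rho> J)) \<and>
     (\<forall>t. bij_betw (\<lambda>x. \<Sum>M | x M \<noteq> 0. x M) (direct_sum_at D t) (V t))"

text \<open>The multiplicity of \<open>k\<^sub>I\<close> in \<open>V\<close> is the cardinal \<open>\<kappa>\<close>. It is only meaningful when a
  decomposition exists and the count does not depend on the decomposition; both are part of the
  definition. Cardinals are compared by \<open>=o\<close>, as the multiplicity may be infinite.\<close>

definition has_multiplicity ::
    "('k::field \<Rightarrow> 'v \<Rightarrow> 'v) \<Rightarrow> ('r::linorder \<Rightarrow> 'v::ab_group_add set) \<Rightarrow>
     ('r \<Rightarrow> 'r \<Rightarrow> 'v \<Rightarrow> 'v) \<Rightarrow> 'r set \<Rightarrow> 'c rel \<Rightarrow> bool" where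
  "has_multiplicity scl V \<rho> I \<kappa> \<longleftrightarrow>
     (\<exists>D. interval_decomposition scl V \<rho> D) \<and>
     (\<forall>D. interval_decomposition scl V \<rho> D \<longrightarrow>
        |{M \<in> D. iso_interval_module scl M \<rho> I}| =o \<kappa>)"

section \<open>Cuts and the spaces \<open>V\<^sup>-\<^sub>I\<close> and \<open>V\<^sup>+\<^sub>I\<close>\<close>

type_synonym 'r cut = "'r set \<times> 'r set"

definition is_cut :: "'r::linorder cut \<Rightarrow> bool" where
  "is_cut c \<longleftrightarrow> fst c \<union> snd c = UNIV \<and> (\<forall>s\<in>fst c. \<forall>t\<in>snd c. s < t)"

definition Im_minus ::
    "('r \<Rightarrow> 'v::zero set) \<Rightarrow> ('r \<Rightarrow> 'r \<Rightarrow> 'v \<Rightarrow> 'v) \<Rightarrow> 'r cut \<Rightarrow> 'r \<Rightarrow> 'v set" where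
  "Im_minus V \<rho> c t = (if fst c = {} then {0} else (\<Union>s\<in>fst c. Im V \<rho> t s))"

definition Im_plus ::
    "('r::linorder \<Rightarrow> 'v set) \<Rightarrow> ('r \<Rightarrow> 'r \<Rightarrow> 'v \<Rightarrow> 'v) \<Rightarrow> 'r cut \<Rightarrow> 'r \<Rightarrow> 'v set" where
  "Im_plus V \<rho> c t = (\<Inter>s\<in>{s \<in> snd c. s \<le> t}. Im V \<rho> t s)"

definition Ker_minus ::
    "('r::linorder \<Rightarrow> 'v::zero set) \<Rightarrow> ('r \<Rightarrow> 'r \<Rightarrow> 'v \<Rightarrow> 'v) \<Rightarrow> 'r cut \<Rightarrow> 'r \<Rightarrow> 'v set" where
  "Ker_minus V \<rho> c t = (\<Union>r\<in>{r \<in> fst c. t \<le> r}. Ker V \<rho> r t)"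

definition Ker_plus ::
    "('r \<Rightarrow> 'v::zero set) \<Rightarrow> ('r \<Rightarrow> 'r \<Rightarrow> 'v \<Rightarrow> 'v) \<Rightarrow> 'r cut \<Rightarrow> 'r \<Rightarrow> 'v set" where
  "Ker_plus V \<rho> c t = (if snd c = {} then V t else (\<Inter>r\<in>snd c. Ker V \<rho> r t))"

definition lower_cut :: "'r::linorder set \<Rightarrow> 'r cut" where
  "lower_cut I = ({t. \<forall>s\<in>I. t < s}, {t. \<exists>s\<in>I. s \<le> t})"

definition upper_cut :: "'r::linorder set \<Rightarrow> 'r cut" where
  "upper_cut I = ({t. \<exists>s\<in>I. t \<le> s}, {t. \<forall>s\<in>I. s < t})"

lemma is_cut_lower_cut: "is_cut (lower_cut I)"
  by (auto simp: is_cut_def lower_cut_def not_less)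

lemma is_cut_upper_cut: "is_cut (upper_cut I)"
  by (auto simp: is_cut_def upper_cut_def not_less)

lemma interval_eq_cuts:
  assumes "order_interval I"
  shows "I = snd (lower_cut I) \<inter> fst (upper_cut I)"
proof
  show "I \<subseteq> snd (lower_cut I) \<inter> fst (upper_cut I)"
    unfolding lower_cut_def upper_cut_def by auto
  show "snd (lower_cut I) \<inter> fst (upper_cut I) \<subseteq> I"
    using assms unfolding order_interval_def lower_cut_def upper_cut_def fst_conv snd_conv by blast
qed

text \<open>In the next definition \<open>+\<close> is the sum of two subspaces.\<close>

definition V_minus_at ::
    "('r::linorder \<Rightarrow> 'v::ab_group_add set) \<Rightarrow> ('r \<Rightarrow> 'r \<Rightarrow> 'v \<Rightarrow> 'v) \<Rightarrow> 'r set \<Rightarrow> 'r \<Rightarrow> 'v set" where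
  "V_minus_at V \<rho> I t =
     (Im_minus V \<rho> (lower_cut I) t \<inter> Ker_plus V \<rho> (upper_cut I) t) +
     (Im_plus V \<rho> (lower_cut I) t \<inter> Ker_minus V \<rho> (upper_cut I) t)"

definition V_plus_at ::
    "('r::linorder \<Rightarrow> 'v::ab_group_add set) \<Rightarrow> ('r \<Rightarrow> 'r \<Rightarrow> 'v \<Rightarrow> 'v) \<Rightarrow> 'r set \<Rightarrow> 'r \<Rightarrow> 'v set" where
  "V_plus_at V \<rho> I t = Im_plus V \<rho> (lower_cut I) t \<inter> Ker_plus V \<rho> (upper_cut I) t"

text \<open>Elements of an inverse limit over \<open>I\<close> are compatible families, extended by 0 outside \<open>I\<close>,
  so that the limit is a subspace of the space of functions with pointwise operations.\<close>

definition inverse_limit ::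
    "'r::linorder set \<Rightarrow> ('r \<Rightarrow> 'v::zero set) \<Rightarrow> ('r \<Rightarrow> 'r \<Rightarrow> 'v \<Rightarrow> 'v) \<Rightarrow> ('r \<Rightarrow> 'v) set" where
  "inverse_limit I X \<rho> =
     {x. (\<forall>t\<in>I. x t \<in> X t) \<and> (\<forall>t. t \<notin> I \<longrightarrow> x t = 0) \<and>
         (\<forall>s\<in>I. \<forall>t\<in>I. s \<le> t \<longrightarrow> \<rho> t s (x s) = x t)}"

definition V_plus ::
    "('r::linorder \<Rightarrow> 'v::ab_group_add set) \<Rightarrow> ('r \<Rightarrow> 'r \<Rightarrow> 'v \<Rightarrow> 'v) \<Rightarrow> 'r set \<Rightarrow> ('r \<Rightarrow> 'v) set" where
  "V_plus V \<rho> I = inverse_limit I (V_plus_at V \<rho> I) \<rho>"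

definition V_minus ::
    "('r::linorder \<Rightarrow> 'v::ab_group_add set) \<Rightarrow> ('r \<Rightarrow> 'r \<Rightarrow> 'v \<Rightarrow> 'v) \<Rightarrow> 'r set \<Rightarrow> ('r \<Rightarrow> 'v) set" where
  "V_minus V \<rho> I = {x \<in> V_plus V \<rho> I. \<forall>t\<in>I. x t \<in> V_minus_at V \<rho> I t}"

section \<open>Dimension of a quotient space\<close>

definition pointwise_scale :: "('k \<Rightarrow> 'v \<Rightarrow> 'v) \<Rightarrow> 'k \<Rightarrow> ('r \<Rightarrow> 'v) \<Rightarrow> 'r \<Rightarrow> 'v" where
  "pointwise_scale scl c x = (\<lambda>t. scl c (x t))"

definition quotient_space :: "'v::ab_group_add set \<Rightarrow> 'v set \<Rightarrow> 'v set set" where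
  "quotient_space U W = (\<lambda>x. x +o W) ` U"

text \<open>A linear combination of cosets in \<open>U / W\<close>, computed as a set: scl each coset elementwise,
  form the Minkowski sum, and add \<open>W\<close>, which gives the zero coset when no \<open>c B\<close> is nonzero.\<close>

definition coset_combination ::
    "('k::zero \<Rightarrow> 'v \<Rightarrow> 'v) \<Rightarrow> 'v::ab_group_add set \<Rightarrow> ('v set \<Rightarrow> 'k) \<Rightarrow> 'v set" where
  "coset_combination scl W c = W + (\<Sum>B | c B \<noteq> 0. scl (c B) ` B)"

definition quotient_basis ::
    "('k::field \<Rightarrow> 'v \<Rightarrow> 'v) \<Rightarrow> 'v::ab_group_add set \<Rightarrow> 'v set \<Rightarrow> 'v set set \<Rightarrow> bool" where
  "quotient_basis scl U W \<B> \<longleftrightarrow>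
     \<B> \<subseteq> quotient_space U W \<and>
     (\<forall>A \<in> quotient_space U W.
        \<exists>!c. finite {B. c B \<noteq> 0} \<and> {B. c B \<noteq> 0} \<subseteq> \<B> \<and> A = coset_combination scl W c)"

text \<open>The dimension of \<open>U / W\<close> as a cardinal; \<^const>\<open>vector_space.dim\<close> is a natural number and
  collapses all infinite dimensions to 0.\<close>

definition quotient_dim ::
    "('k::field \<Rightarrow> 'v \<Rightarrow> 'v) \<Rightarrow> 'v::ab_group_add set \<Rightarrow> 'v set \<Rightarrow> 'v set rel" where
  "quotient_dim scl U W = |SOME \<B>. quotient_basis scl U W \<B>|"

end

theory Submission
  imports Defs
begin

text \<open>
  An interval \<open>I\<close> has a subquotient \<open>V_plus_at V \<rho> I t / V_minus_at V \<rho> I t\<close> of \<open>V t\<close> for every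
  \<open>t \<in> I\<close>: vectors that come from as far down as \<open>I\<close> reaches and die when \<open>I\<close> ends, modulo those that
  come from further down or die earlier. In an interval module this is the whole line if the
  module is the one of \<open>I\<close>, and zero otherwise. The theorem says that the subquotients
  count summands, and that there are always enough summands to be counted.

  Counting is the easier half (\<open>card_summands\<close>). Projecting to a summand commutes with the structure maps, hence preserves images, kernels, and everything
  built from them. So at a fixed \<open>t \<in> I\<close> the components of a vector of \<open>V_plus_at\<close> lie in
  \<open>V_minus_at\<close> except in the copies of the interval module of \<open>I\<close>, and there
  \<open>V_minus_at\<close> is zero. Since a compatible family lies in \<open>V_minus\<close> as soon as it does so at one
  \<open>t\<close> (\<open>V_minus_iff\<close>), the generators of those copies form a basis of \<open>V_plus\<close> modulo \<open>V_minus\<close>. This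
  holds for every decomposition; so the count does not depend on the decomposition, because two
  bases of one quotient space are equipotent (\<open>quotient_dim_eq_card\<close>).

  For existence, choose for each interval \<open>I\<close> a basis of \<open>V_plus\<close> modulo \<open>V_minus\<close>, consisting of compatible
  families. Each of them spans a submodule that is an interval module of \<open>I\<close>, and
  it remains to see that the values at \<open>t\<close> of all these families, for all \<open>I\<close> containing \<open>t\<close>, form a
  basis of \<open>V t\<close>. They are independent because the intervals containing \<open>t\<close> index a chain of
  pairs of subspaces of \<open>V t\<close> (\<open>sections_comparable\<close>), whose quotients are the subquotients above.
  They span because every proper subspace of \<open>V t\<close> is left by the subquotient of some interval
  (\<open>interval_detects_proper_subspace\<close>). The chain conditions enter there, and in lifting vectors of
  limiting images along the structure maps (\<open>image_Im_plus\<close>). Spanning also uses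
  that every vector of \<open>V_plus_at\<close> extends to a compatible family. That is a Mittag-Leffler argument
  (\<open>V_plus_lift\<close>), and it needs a countable set that reaches the lower end of \<open>I\<close>, which
  the countable dense subset of the index set supplies.
\<close>

section \<open>Bases of quotient spaces\<close>

locale nested_subspaces = vector_space scale
  for scale :: "'k::field \<Rightarrow> 'b::ab_group_add \<Rightarrow> 'b" +
  fixes U W :: "'b set"
  assumes U: "subspace U" and W: "subspace W" and W_subset: "W \<subseteq> U"
begin

text \<open>The basis is an indexed family of representatives, so that it can be indexed by the summands of
  a decomposition and counted by them.\<close>

definition basis_modulo :: "('i \<Rightarrow> 'b) \<Rightarrow> 'i set \<Rightarrow> bool" where
  "basis_modulo g A \<longleftrightarrow>
     g ` A \<subseteq> U \<and>
     (\<forall>S c. finite S \<longrightarrow> S \<subseteq> A \<longrightarrow> (\<Sum>i\<in>S. scale (c i) (g i)) \<in> W \<longrightarrow> (\<forall>i\<in>S. c i = 0)) \<and>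
     (\<forall>x\<in>U. \<exists>S c. finite S \<and> S \<subseteq> A \<and> x - (\<Sum>i\<in>S. scale (c i) (g i)) \<in> W)"

lemma basis_moduloD:
  fixes g :: "'i \<Rightarrow> 'b"
  assumes "basis_modulo g A"
  shows "i \<in> A \<Longrightarrow> g i \<in> U"
    and "\<lbrakk>finite S; S \<subseteq> A; (\<Sum>i\<in>S. scale (c i) (g i)) \<in> W; i \<in> S\<rbrakk> \<Longrightarrow> c i = 0"
    and "x \<in> U \<Longrightarrow> \<exists>S c. finite S \<and> S \<subseteq> A \<and> x - (\<Sum>i\<in>S. scale (c i) (g i)) \<in> W"
proof -
  note bas = assms[unfolded basis_modulo_def]
  show "i \<in> A \<Longrightarrow> g i \<in> U"
    using bas[THEN conjunct1] by blast
  show "\<lbrakk>finite S; S \<subseteq> A; (\<Sum>i\<in>S. scale (c i) (g i)) \<in> W; i \<in> S\<rbrakk> \<Longrightarrow> c i = 0"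
    by (rule bas[THEN conjunct2, THEN conjunct1, rule_format])
  show "x \<in> U \<Longrightarrow> \<exists>S c. finite S \<and> S \<subseteq> A \<and> x - (\<Sum>i\<in>S. scale (c i) (g i)) \<in> W"
    by (rule bas[THEN conjunct2, THEN conjunct2, rule_format])
qed

text \<open>Linear algebra modulo \<open>W\<close> becomes linear algebra inside the ambient space after applying
  the projection onto a complement of \<open>W\<close>.\<close>

lemma exists_projection_along:
  obtains p where "Vector_Spaces.linear scale scale p"
    "\<And>x. p x = 0 \<longleftrightarrow> x \<in> W" "\<And>x. x - p x \<in> W"
proof -
  interpret pair: vector_space_pair scale scale by unfold_locales
  obtain g where g: "range g \<subseteq> W" "Vector_Spaces.linear scale scale g" "\<forall>w\<in>W. g (id w) = w"
    using pair.linear_exists_left_inverse_on[OF linear_id W inj_on_id] by blast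
  have gW: "g x \<in> W" for x
    using g(1) by blast
  show thesis
  proof
    show "Vector_Spaces.linear scale scale (\<lambda>x. x - g x)"
      using pair.linear_compose_sub[OF linear_id g(2)] by simp
    show "x - g x = 0 \<longleftrightarrow> x \<in> W" for x
    proof
      assume "x - g x = 0"
      then have "x = g x" by simp
      then show "x \<in> W" using gW[of x] by simp
    next
      assume "x \<in> W"
      then have "g x = x" using g(3) by simp
      then show "x - g x = 0" by simp
    qed
    show "x - (x - g x) \<in> W" for x
      using gW[of x] by simp
  qed
qed

lemma exists_basis_modulo:
  shows "\<exists>B. basis_modulo (\<lambda>b. b) B"
proof -
  obtain p where lin: "Vector_Spaces.linear scale scale p"
    and p0: "\<And>x. p x = 0 \<longleftrightarrow> x \<in> W" and pW: "\<And>x. x - p x \<in> W"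
    using exists_projection_along by metis
  interpret p: Vector_Spaces.linear scale scale p by (rule lin)
  have pp: "p (p x) = p x" for x
    using pW[of x] p0[of "x - p x"] by (simp add: p.diff)
  have pU: "p x \<in> U" if "x \<in> U" for x
    using subspace_diff[OF U that, of "x - p x"] pW[of x] W_subset by auto
  obtain B where B: "B \<subseteq> p ` U" "independent B" "p ` U \<subseteq> span B"
    using maximal_independent_subset by metis
  have fix_B: "p b = b" if "b \<in> B" for b
    using that B(1) pp by auto
  have "basis_modulo (\<lambda>b. b) B"
    unfolding basis_modulo_def
  proof (intro conjI allI impI ballI)
    show "(\<lambda>b. b) ` B \<subseteq> U"
      using B(1) pU by auto
  next
    fix S c b assume S: "finite S" "S \<subseteq> B" "(\<Sum>b\<in>S. scale (c b) b) \<in> W" "b \<in> S"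
    have "(\<Sum>b\<in>S. scale (c b) b) = (\<Sum>b\<in>S. scale (c b) (p b))"
      using fix_B S(2) by (intro sum.cong) auto
    also have "\<dots> = p (\<Sum>b\<in>S. scale (c b) b)"
      by (simp add: p.sum p.scale)
    also have "\<dots> = 0"
      using S(3) p0 by blast
    finally show "c b = 0"
      using B(2) S(1,2,4) unfolding independent_explicit_finite_subsets by blast
  next
    fix x assume "x \<in> U"
    then have "p x \<in> span B"
      using B(3) by blast
    then obtain S c where S: "finite S" "S \<subseteq> B" "p x = (\<Sum>b\<in>S. scale (c b) b)"
      unfolding span_explicit by blast
    then have "x - (\<Sum>b\<in>S. scale (c b) b) \<in> W"
      using pW[of x] by simp
    with S show "\<exists>S c. finite S \<and> S \<subseteq> B \<and> x - (\<Sum>b\<in>S. scale (c b) b) \<in> W"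
      by blast
  qed
  then show ?thesis ..
qed

lemma basis_modulo_inj_on:
  assumes bas: "basis_modulo g A" and "i \<in> A" "j \<in> A" and mem: "g i - g j \<in> W"
  shows "i = j"
proof (rule ccontr)
  assume "i \<noteq> j"
  define c where "c = (\<lambda>l. if l = i then 1 else - 1 :: 'k)"
  have "(\<Sum>l\<in>{i, j}. scale (c l) (g l)) = g i - g j"
    using \<open>i \<noteq> j\<close> by (simp add: c_def)
  then have "c i = 0"
    using basis_moduloD(2)[OF bas, of "{i, j}" c i] assms by simp
  then show False
    by (simp add: c_def)
qed

text \<open>Completing both families by one basis of \<open>W\<close> gives two bases of \<open>U\<close>, but that does not compare
  their cardinalities when \<open>W\<close> has infinite dimension. The projection instead turns them into two
  bases of the same subspace.\<close>

lemma basis_modulo_card_eq: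
  assumes g: "basis_modulo g A" and h: "basis_modulo h B"
  shows "|A| =o |B|"
proof -
  obtain p where lin: "Vector_Spaces.linear scale scale p"
    and p0: "\<And>x. p x = 0 \<longleftrightarrow> x \<in> W"
    using exists_projection_along by metis
  interpret p: Vector_Spaces.linear scale scale p by (rule lin)
  \<comment> \<open>A basis modulo \<open>W\<close> is sent by \<open>p\<close> injectively to a basis of \<open>p ` U\<close>.\<close>
  have *: "inj_on (\<lambda>i. p (g i)) A \<and> independent ((\<lambda>i. p (g i)) ` A) \<and>
      span ((\<lambda>i. p (g i)) ` A) = span (p ` U)"
    if bas: "basis_modulo g A" for g :: "'i \<Rightarrow> 'b" and A
  proof (intro conjI)
    show inj: "inj_on (\<lambda>i. p (g i)) A"
    proof (rule inj_onI)
      fix i j assume "i \<in> A" "j \<in> A" "p (g i) = p (g j)"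
      then show "i = j"
        using basis_modulo_inj_on[OF bas] p0[of "g i - g j"] by (simp add: p.diff)
    qed
    show "independent ((\<lambda>i. p (g i)) ` A)"
      unfolding independent_explicit_finite_subsets
    proof (intro allI impI ballI)
      fix T c v assume T: "T \<subseteq> (\<lambda>i. p (g i)) ` A" "finite T" "(\<Sum>v\<in>T. scale (c v) v) = 0" "v \<in> T"
      obtain S where S: "S \<subseteq> A" "finite S" "T = (\<lambda>i. p (g i)) ` S"
        using T(1,2) by (meson finite_subset_image)
      have "p (\<Sum>i\<in>S. scale (c (p (g i))) (g i)) = (\<Sum>i\<in>S. scale (c (p (g i))) (p (g i)))"
        by (simp add: p.sum p.scale)
      also have "\<dots> = (\<Sum>v\<in>T. scale (c v) v)"
        unfolding S(3) using inj_on_subset[OF inj S(1)] by (subst sum.reindex) auto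
      finally have "(\<Sum>i\<in>S. scale (c (p (g i))) (g i)) \<in> W"
        using T(3) p0 by auto
      then have "c (p (g i)) = 0" if "i \<in> S" for i
        using basis_moduloD(2)[OF bas S(2,1), of "\<lambda>i. c (p (g i))"] that by auto
      then show "c v = 0"
        using S(3) T(4) by auto
    qed
    show "span ((\<lambda>i. p (g i)) ` A) = span (p ` U)"
    proof (rule subset_antisym; rule span_minimal)
      show "(\<lambda>i. p (g i)) ` A \<subseteq> span (p ` U)"
        using basis_moduloD(1)[OF bas] by (auto intro: span_base)
      show "p ` U \<subseteq> span ((\<lambda>i. p (g i)) ` A)"
      proof
        fix y assume "y \<in> p ` U"
        then obtain x where x: "x \<in> U" "y = p x" by blast
        then obtain S c where S: "finite S" "S \<subseteq> A" "x - (\<Sum>i\<in>S. scale (c i) (g i)) \<in> W"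
          using basis_moduloD(3)[OF bas] by blast
        then have "p (x - (\<Sum>i\<in>S. scale (c i) (g i))) = 0"
          using p0 by blast
        then have "y = (\<Sum>i\<in>S. scale (c i) (p (g i)))"
          using x by (simp add: p.diff p.sum p.scale)
        then show "y \<in> span ((\<lambda>i. p (g i)) ` A)"
          using S(2) by (simp only:) (intro span_sum span_scale span_base, blast)
      qed
    qed (rule subspace_span)+
  qed
  have "\<exists>f. bij_betw f ((\<lambda>i. p (g i)) ` A) ((\<lambda>i. p (h i)) ` B)"
    using *[OF g] *[OF h] by (intro bij_if_span_eq_span_bases) auto
  then have "|(\<lambda>i. p (g i)) ` A| =o |(\<lambda>i. p (h i)) ` B|"
    using card_of_ordIso by blast
  moreover have "|A| =o |(\<lambda>i. p (g i)) ` A|"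
    using *[OF g] card_of_ordIsoI inj_on_imp_bij_betw by blast
  moreover have "|B| =o |(\<lambda>i. p (h i)) ` B|"
    using *[OF h] card_of_ordIsoI inj_on_imp_bij_betw by blast
  ultimately show ?thesis
    by (meson ordIso_symmetric ordIso_transitive)
qed

lemma coset_eq_iff:
  shows "x +o W = y +o W \<longleftrightarrow> x - y \<in> W"
proof
  assume "x +o W = y +o W"
  moreover have "x \<in> x +o W"
    using subspace_0[OF W] by (force simp: elt_set_plus_def)
  ultimately show "x - y \<in> W"
    by (simp add: set_minus_plus)
next
  have *: "x +o W \<subseteq> y +o W" if "x - y \<in> W" for x y
  proof
    fix z assume "z \<in> x +o W"
    then have "z - x \<in> W" by (simp add: set_minus_plus)
    then have "(z - x) + (x - y) \<in> W" using that subspace_add[OF W] by blast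
    then show "z \<in> y +o W" by (simp flip: set_minus_plus)
  qed
  assume "x - y \<in> W"
  moreover from this have "y - x \<in> W"
    using subspace_neg[OF W, of "x - y"] by simp
  ultimately show "x +o W = y +o W"
    using * by blast
qed

lemma coset_combination_eq:
  assumes fin: "finite {B. c B \<noteq> 0}"
    and rep: "\<And>B. c B \<noteq> 0 \<Longrightarrow> B = rep B +o W"
  shows "coset_combination scale W c = (\<Sum>B | c B \<noteq> 0. scale (c B) (rep B)) +o W"
proof -
  have W2: "W + W = W"
    using set_zero_plus2[OF subspace_0[OF W]]
    by (auto elim!: set_plus_elim intro: subspace_add[OF W])
  have one: "scale a ` (x +o W) = scale a x +o W" if "a \<noteq> 0" for a x
  proof
    show "scale a ` (x +o W) \<subseteq> scale a x +o W"
      by (auto simp: elt_set_plus_def scale_right_distrib intro!: subspace_scale[OF W])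
    show "scale a x +o W \<subseteq> scale a ` (x +o W)"
    proof
      fix z assume "z \<in> scale a x +o W"
      then obtain w where w: "w \<in> W" "z = scale a x + w"
        by (auto simp: elt_set_plus_def)
      then have "z = scale a (x + scale (inverse a) w)"
        using that by (simp add: scale_right_distrib)
      then show "z \<in> scale a ` (x +o W)"
        using w(1) subspace_scale[OF W] by blast
    qed
  qed
  have "W + (\<Sum>B\<in>S. scale (c B) ` B) = (\<Sum>B\<in>S. scale (c B) (rep B)) +o W"
    if "finite S" "S \<subseteq> {B. c B \<noteq> 0}" for S
    using that
  proof (induction S rule: finite_induct)
    case empty
    then show ?case by simp
  next
    case (insert B S)
    then have cB: "c B \<noteq> 0" by simp
    have "scale (c B) ` B = scale (c B) ` (rep B +o W)"
      using rep[OF cB] by (rule arg_cong)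
    then have B: "scale (c B) ` B = scale (c B) (rep B) +o W"
      using one[OF cB] by simp
    (* The extra summand W in the combination absorbs one W for each coset added. *)
    have "W + (\<Sum>B\<in>insert B S. scale (c B) ` B) = scale (c B) ` B + (W + (\<Sum>B\<in>S. scale (c B) ` B))"
      unfolding sum.insert[OF insert.hyps] by (rule add.left_commute)
    also have "\<dots> = (scale (c B) (rep B) +o W) + ((\<Sum>B\<in>S. scale (c B) (rep B)) +o W)"
      using insert B by simp
    also have "\<dots> = (\<Sum>B\<in>insert B S. scale (c B) (rep B)) +o W"
      using insert by (simp add: set_plus_rearrange W2)
    finally show ?case .
  qed
  then show ?thesis
    using fin by (simp add: coset_combination_def)
qed

text \<open>The coefficient functions in the definition of a quotient basis are total with finite support,
  whereas the coefficients in \<open>basis_modulo\<close> matter only on a finite set. The proof extends by zero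
  and uses that a sum of cosets is the coset of the sum of representatives.\<close>

lemma quotient_basis_iff_basis_modulo:
  assumes rep_U: "\<And>B. B \<in> \<B> \<Longrightarrow> rep B \<in> U"
    and rep: "\<And>B. B \<in> \<B> \<Longrightarrow> B = rep B +o W"
  shows "quotient_basis scale U W \<B> \<longleftrightarrow> basis_modulo rep \<B>"
proof -
  have comb: "coset_combination scale W c = (\<Sum>B | c B \<noteq> 0. scale (c B) (rep B)) +o W"
    if "finite {B. c B \<noteq> 0}" "{B. c B \<noteq> 0} \<subseteq> \<B>" for c
    using that by (intro coset_combination_eq rep) auto
  have zero_ext: "(\<Sum>B | d B \<noteq> 0. scale (d B) (rep B)) = (\<Sum>B\<in>S. scale (d B) (rep B))"
    if "finite S" "{B. d B \<noteq> 0} \<subseteq> S" for S d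
    using that by (intro sum.mono_neutral_left) auto
  show ?thesis
  proof
    assume Q: "quotient_basis scale U W \<B>"
    show "basis_modulo rep \<B>"
      unfolding basis_modulo_def
    proof (intro conjI allI impI ballI)
      show "rep ` \<B> \<subseteq> U" using rep_U by blast
    next
      fix S c B assume S: "finite S" "S \<subseteq> \<B>" "(\<Sum>B\<in>S. scale (c B) (rep B)) \<in> W" "B \<in> S"
      define d where "d = (\<lambda>B. if B \<in> S then c B else 0)"
      have sub: "{B. d B \<noteq> 0} \<subseteq> S" by (auto simp: d_def)
      have fin: "finite {B. d B \<noteq> 0}" using sub S(1) finite_subset by blast
      have "(\<Sum>B | d B \<noteq> 0. scale (d B) (rep B)) = (\<Sum>B\<in>S. scale (c B) (rep B))"
        unfolding zero_ext[OF S(1) sub] by (intro sum.cong) (auto simp: d_def)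
      then have "coset_combination scale W d = 0 +o W"
        using comb[OF fin order_trans[OF sub S(2)]] S(3)
          coset_eq_iff[of "\<Sum>B\<in>S. scale (c B) (rep B)" 0] by simp
      moreover have "coset_combination scale W (\<lambda>_. 0) = 0 +o W"
        using comb[of "\<lambda>_. 0"] by simp
      moreover have "0 +o W \<in> quotient_space U W"
        using subspace_0[OF U] unfolding quotient_space_def by blast
      ultimately have "d = (\<lambda>_. 0)"
        using Q fin sub S(2) unfolding quotient_basis_def
        by (metis (mono_tags, lifting) Collect_empty_eq empty_subsetI finite.emptyI order_trans)
      then show "c B = 0"
        using S(4) by (metis d_def)
    next
      fix x assume "x \<in> U"
      then have "x +o W \<in> quotient_space U W"
        by (simp add: quotient_space_def)
      then obtain c where c: "finite {B. c B \<noteq> 0}" "{B. c B \<noteq> 0} \<subseteq> \<B>"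
          "x +o W = coset_combination scale W c"
        using Q unfolding quotient_basis_def by blast
      then show "\<exists>S c. finite S \<and> S \<subseteq> \<B> \<and> x - (\<Sum>B\<in>S. scale (c B) (rep B)) \<in> W"
        using comb[OF c(1,2)] coset_eq_iff by auto
    qed
  next
    assume bas: "basis_modulo rep \<B>"
    show "quotient_basis scale U W \<B>"
      unfolding quotient_basis_def
    proof (intro conjI ballI)
      show "\<B> \<subseteq> quotient_space U W"
        using rep_U rep unfolding quotient_space_def by blast
      fix A assume "A \<in> quotient_space U W"
      then obtain x where x: "x \<in> U" "A = x +o W"
        by (auto simp: quotient_space_def)
      obtain S c where S: "finite S" "S \<subseteq> \<B>" "x - (\<Sum>B\<in>S. scale (c B) (rep B)) \<in> W"
        using basis_moduloD(3)[OF bas x(1)] by blast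
      define d where "d = (\<lambda>B. if B \<in> S then c B else 0)"
      have sub: "{B. d B \<noteq> 0} \<subseteq> S" by (auto simp: d_def)
      have fin: "finite {B. d B \<noteq> 0}" using sub S(1) finite_subset by blast
      have "(\<Sum>B | d B \<noteq> 0. scale (d B) (rep B)) = (\<Sum>B\<in>S. scale (c B) (rep B))"
        unfolding zero_ext[OF S(1) sub] by (intro sum.cong) (auto simp: d_def)
      then have A: "A = coset_combination scale W d"
        using comb[OF fin order_trans[OF sub S(2)]] S(3)
          coset_eq_iff[of x "\<Sum>B\<in>S. scale (c B) (rep B)"] x(2) by simp
      show "\<exists>!c. finite {B. c B \<noteq> 0} \<and> {B. c B \<noteq> 0} \<subseteq> \<B> \<and> A = coset_combination scale W c"
      proof (intro ex1I[of _ d] conjI fin A)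
        show "{B. d B \<noteq> 0} \<subseteq> \<B>" using sub S(2) by blast
        fix e assume e: "finite {B. e B \<noteq> 0} \<and> {B. e B \<noteq> 0} \<subseteq> \<B> \<and> A = coset_combination scale W e"
        let ?T = "{B. d B \<noteq> 0} \<union> {B. e B \<noteq> 0}"
        have T: "finite ?T" "?T \<subseteq> \<B>" using e fin sub S(2) by auto
        have "(\<Sum>B\<in>?T. scale (e B) (rep B)) - (\<Sum>B\<in>?T. scale (d B) (rep B)) \<in> W"
          using A e comb[of e] comb[OF fin] sub S(2) coset_eq_iff
            zero_ext[OF T(1), of e] zero_ext[OF T(1), of d] by auto
        then have "(\<Sum>B\<in>?T. scale (e B - d B) (rep B)) \<in> W"
          by (simp add: scale_left_diff_distrib sum_subtractf)
        then have "e B - d B = 0" if "B \<in> ?T" for B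
          using basis_moduloD(2)[OF bas T, of "\<lambda>B. e B - d B"] that by blast
        then have "e B = d B" for B
          by (cases "B \<in> ?T") auto
        then show "e = d" ..
      qed
    qed
  qed
qed

text \<open>Passing from a family of representatives to its set of cosets loses nothing, because
  representatives independent modulo \<open>W\<close> lie in distinct cosets.\<close>

lemma quotient_dim_eq_card:
  assumes bas: "basis_modulo g A"
  shows "|A| =o quotient_dim scale U W"
proof -
  let ?q = "\<lambda>i. g i +o W"
  have inj: "inj_on ?q A"
    using basis_modulo_inj_on[OF bas] coset_eq_iff by (auto intro: inj_onI)
  define r where "r = (\<lambda>B. g (inv_into A ?q B))"
  have inv: "inv_into A ?q (g i +o W) = i" if "i \<in> A" for i
    using inv_into_f_f[OF inj that] .
  then have r: "r (g i +o W) = g i" if "i \<in> A" for i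
    using that by (simp add: r_def)
  have "basis_modulo r (?q ` A)"
    unfolding basis_modulo_def
  proof (intro conjI allI impI ballI)
    show "r ` ?q ` A \<subseteq> U"
      using r basis_moduloD(1)[OF bas] by auto
  next
    fix T c B assume T: "finite T" "T \<subseteq> ?q ` A" "(\<Sum>B\<in>T. scale (c B) (r B)) \<in> W" "B \<in> T"
    obtain S where S: "S \<subseteq> A" "finite S" "T = ?q ` S"
      using T(1,2) by (meson finite_subset_image)
    have "(\<Sum>B\<in>T. scale (c B) (r B)) = (\<Sum>i\<in>S. scale (c (?q i)) (g i))"
      unfolding S(3) sum.reindex[OF inj_on_subset[OF inj S(1)]]
      using S(1) r by (intro sum.cong) auto
    then have "c (?q i) = 0" if "i \<in> S" for i
      using basis_moduloD(2)[OF bas S(2,1), of "\<lambda>i. c (?q i)"] T(3) that by auto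
    then show "c B = 0" using T(4) S(3) by auto
  next
    fix x assume "x \<in> U"
    then obtain S c where S: "finite S" "S \<subseteq> A" "x - (\<Sum>i\<in>S. scale (c i) (g i)) \<in> W"
      using basis_moduloD(3)[OF bas] by blast
    have "(\<Sum>B\<in>?q ` S. scale (c (inv_into A ?q B)) (r B)) = (\<Sum>i\<in>S. scale (c i) (g i))"
      unfolding sum.reindex[OF inj_on_subset[OF inj S(2)]]
      using S(2) r inv by (intro sum.cong) auto
    then show "\<exists>T c. finite T \<and> T \<subseteq> ?q ` A \<and> x - (\<Sum>B\<in>T. scale (c B) (r B)) \<in> W"
      using S by (intro exI[of _ "?q ` S"] exI[of _ "\<lambda>B. c (inv_into A ?q B)"]) auto
  qed
  moreover have "r B \<in> U" "B = r B +o W" if "B \<in> ?q ` A" for B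
    using that r basis_moduloD(1)[OF bas] by auto
  ultimately have "quotient_basis scale U W (?q ` A)"
    using quotient_basis_iff_basis_modulo[of "?q ` A" r] by blast
  then have some: "quotient_basis scale U W (SOME \<B>. quotient_basis scale U W \<B>)"
      (is "quotient_basis scale U W ?\<B>")
    by (rule someI)
  have "\<exists>x. x \<in> U \<and> B = x +o W" if "B \<in> ?\<B>" for B
    using some that unfolding quotient_basis_def quotient_space_def by blast
  then obtain rep where "\<And>B. B \<in> ?\<B> \<Longrightarrow> rep B \<in> U" "\<And>B. B \<in> ?\<B> \<Longrightarrow> B = rep B +o W"
    by metis
  then have "basis_modulo rep ?\<B>"
    using quotient_basis_iff_basis_modulo[of ?\<B> rep] some by blast
  then show ?thesis
    unfolding quotient_dim_def by (rule basis_modulo_card_eq[OF bas])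
qed

end

section \<open>Images and kernels along cuts\<close>

context vector_space
begin

lemma subspace_Union_chain:
  assumes ne: "\<C> \<noteq> {}" and sub: "\<And>X. X \<in> \<C> \<Longrightarrow> subspace X"
    and chain: "\<And>X Y. X \<in> \<C> \<Longrightarrow> Y \<in> \<C> \<Longrightarrow> X \<subseteq> Y \<or> Y \<subseteq> X"
  shows "subspace (\<Union>\<C>)"
  unfolding subspace_def
proof (intro conjI ballI allI)
  show "0 \<in> \<Union>\<C>" using ne sub subspace_0 by blast
  show "scale a x \<in> \<Union>\<C>" if "x \<in> \<Union>\<C>" for a x
    using that sub subspace_scale by blast
  show "x + y \<in> \<Union>\<C>" if xy: "x \<in> \<Union>\<C>" "y \<in> \<Union>\<C>" for x y
  proof -
    obtain X Y where "X \<in> \<C>" "x \<in> X" "Y \<in> \<C>" "y \<in> Y" using xy by blast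
    then have "\<exists>Z\<in>\<C>. x \<in> Z \<and> y \<in> Z"
      using chain[of X Y] by blast
    then show ?thesis
      using sub subspace_add by blast
  qed
qed

lemma subspace_set_plus:
  assumes "subspace A" "subspace B"
  shows "subspace (A + B)"
proof -
  have "A + B = {x + y |x y. x \<in> A \<and> y \<in> B}"
    by (auto simp: set_plus_def)
  then show ?thesis
    using subspace_sums[OF assms] by simp
qed

end

context persistence_module
begin

lemma \<rho>_closed:
  assumes "s \<le> t" "x \<in> V s"
  shows "\<rho> t s x \<in> V t"
  using linear_\<rho>[OF assms(1)] assms(2) by (simp add: linear_between_def image_subset_iff)

lemma \<rho>_add:
  assumes "s \<le> t" "x \<in> V s" "y \<in> V s"
  shows "\<rho> t s (x + y) = \<rho> t s x + \<rho> t s y"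
  using linear_\<rho>[OF assms(1)] assms(2,3) by (simp add: linear_between_def)

lemma \<rho>_scale:
  assumes "s \<le> t" "x \<in> V s"
  shows "\<rho> t s (scale a x) = scale a (\<rho> t s x)"
  using linear_\<rho>[OF assms(1)] assms(2) by (simp add: linear_between_def)

lemma zero_in_V: "0 \<in> V t"
  by (rule subspace_0[OF subspace_V])

lemma \<rho>_zero: "s \<le> t \<Longrightarrow> \<rho> t s 0 = 0"
  using \<rho>_add[of s t 0 0] zero_in_V by simp

lemma \<rho>_diff: "s \<le> t \<Longrightarrow> x \<in> V s \<Longrightarrow> y \<in> V s \<Longrightarrow> \<rho> t s (x - y) = \<rho> t s x - \<rho> t s y"
  using \<rho>_add[of s t "x - y" y] subspace_diff[OF subspace_V] by (simp add: algebra_simps)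

lemma \<rho>_sum:
  assumes "s \<le> t" and "\<And>i. i \<in> S \<Longrightarrow> f i \<in> V s"
  shows "\<rho> t s (\<Sum>i\<in>S. f i) = (\<Sum>i\<in>S. \<rho> t s (f i))"
  using assms(2)
proof (induction S rule: infinite_finite_induct)
  case (insert i S)
  then show ?case
    using \<rho>_add[OF assms(1)] subspace_sum[OF subspace_V, of S f] by simp
qed (simp_all add: \<rho>_zero[OF assms(1)])

lemma subspace_Im:
  assumes "s \<le> t"
  shows "subspace (Im V \<rho> t s)"
  unfolding Im_def
proof (rule subspaceI)
  show "0 \<in> \<rho> t s ` V s"
    using \<rho>_zero[OF assms] zero_in_V by force
next
  fix x y assume "x \<in> \<rho> t s ` V s" "y \<in> \<rho> t s ` V s"
  then show "x + y \<in> \<rho> t s ` V s"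
    using subspace_add[OF subspace_V, of _ s] by (auto simp flip: \<rho>_add[OF assms])
next
  fix a x assume "x \<in> \<rho> t s ` V s"
  then show "scale a x \<in> \<rho> t s ` V s"
    using subspace_scale[OF subspace_V, of _ s] by (auto simp flip: \<rho>_scale[OF assms])
qed

lemma subspace_Ker: "t \<le> r \<Longrightarrow> subspace (Ker V \<rho> r t)"
  unfolding Ker_def subspace_def
  using subspace_0[OF subspace_V] subspace_add[OF subspace_V] subspace_scale[OF subspace_V]
  by (auto simp: \<rho>_zero \<rho>_add \<rho>_scale)

lemma \<rho>_in_Im: "s \<le> t \<Longrightarrow> x \<in> V s \<Longrightarrow> \<rho> t s x \<in> Im V \<rho> t s"
  unfolding Im_def by blast

lemma Im_self: "Im V \<rho> t t = V t"
  unfolding Im_def using \<rho>_id by simp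

lemma image_Im: "r \<le> s \<Longrightarrow> s \<le> t \<Longrightarrow> \<rho> t s ` Im V \<rho> s r = Im V \<rho> t r"
  unfolding Im_def image_image using \<rho>_comp by simp

lemma Im_mono: "r \<le> s \<Longrightarrow> s \<le> t \<Longrightarrow> Im V \<rho> t r \<subseteq> Im V \<rho> t s"
  using \<rho>_closed[of r s] by (force simp: Im_def simp flip: \<rho>_comp[of r s t])

lemma \<rho>_in_Ker_iff: "s \<le> t \<Longrightarrow> t \<le> r \<Longrightarrow> x \<in> V s \<Longrightarrow> \<rho> t s x \<in> Ker V \<rho> r t \<longleftrightarrow> x \<in> Ker V \<rho> r s"
  unfolding Ker_def using \<rho>_closed \<rho>_comp by auto

lemma Ker_mono: "t \<le> r \<Longrightarrow> r \<le> r' \<Longrightarrow> Ker V \<rho> r t \<subseteq> Ker V \<rho> r' t"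
  unfolding Ker_def by (auto simp: \<rho>_zero simp flip: \<rho>_comp[of t r r'])

lemma subspace_Im_minus:
  assumes c: "is_cut c" and t: "t \<in> snd c"
  shows "subspace (Im_minus V \<rho> c t)"
proof (cases "fst c = {}")
  case False
  have lt: "s < t" if "s \<in> fst c" for s
    using c t that unfolding is_cut_def by blast
  have "subspace (\<Union>(Im V \<rho> t ` fst c))"
  proof (rule subspace_Union_chain)
    fix X Y assume "X \<in> Im V \<rho> t ` fst c" "Y \<in> Im V \<rho> t ` fst c"
    then obtain r s where rs: "r \<in> fst c" "s \<in> fst c" "X = Im V \<rho> t r" "Y = Im V \<rho> t s"
      by blast
    then show "X \<subseteq> Y \<or> Y \<subseteq> X"
      using Im_mono[of r s t] Im_mono[of s r t] lt by (meson le_cases less_imp_le)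
  qed (use False subspace_Im lt in \<open>auto simp: less_imp_le\<close>)
  with False show ?thesis by (simp add: Im_minus_def)
qed (simp add: Im_minus_def)

lemma subspace_Im_plus: "subspace (Im_plus V \<rho> c t)"
  unfolding Im_plus_def by (rule subspace_Inter) (use subspace_Im in blast)

lemma subspace_Ker_minus:
  assumes t: "t \<in> fst c"
  shows "subspace (Ker_minus V \<rho> c t)"
  unfolding Ker_minus_def
proof (rule subspace_Union_chain)
  fix X Y assume "X \<in> (\<lambda>r. Ker V \<rho> r t) ` {r \<in> fst c. t \<le> r}" "Y \<in> (\<lambda>r. Ker V \<rho> r t) ` {r \<in> fst c. t \<le> r}"
  then obtain r s where rs: "t \<le> r" "t \<le> s" "X = Ker V \<rho> r t" "Y = Ker V \<rho> s t"
    by blast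
  then show "X \<subseteq> Y \<or> Y \<subseteq> X"
    using Ker_mono[of t r s] Ker_mono[of t s r] by (meson le_cases)
qed (use t subspace_Ker in auto)

lemma subspace_Ker_plus:
  assumes c: "is_cut c" and t: "t \<in> fst c"
  shows "subspace (Ker_plus V \<rho> c t)"
proof (cases "snd c = {}")
  case False
  have "subspace (\<Inter>((\<lambda>r. Ker V \<rho> r t) ` snd c))"
    using c t subspace_Ker unfolding is_cut_def by (intro subspace_Inter) (auto simp: less_imp_le)
  with False show ?thesis by (simp add: Ker_plus_def)
qed (simp add: Ker_plus_def subspace_V)

lemma Im_plus_subset_V: "t \<in> snd c \<Longrightarrow> Im_plus V \<rho> c t \<subseteq> V t"
  unfolding Im_plus_def using Im_self by blast

lemma Im_minus_subset_Im_plus: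
  assumes c: "is_cut c" and t: "t \<in> snd c"
  shows "Im_minus V \<rho> c t \<subseteq> Im_plus V \<rho> c t"
proof (cases "fst c = {}")
  case True
  then show ?thesis
    using subspace_0[OF subspace_Im_plus] by (simp add: Im_minus_def)
next
  case False
  have "Im V \<rho> t r \<subseteq> Im V \<rho> t s" if "r \<in> fst c" "s \<in> snd c" "s \<le> t" for r s
    using that c unfolding is_cut_def by (intro Im_mono) (auto simp: less_imp_le)
  with False show ?thesis by (force simp: Im_minus_def Im_plus_def)
qed

lemma Ker_minus_subset_Ker_plus:
  assumes c: "is_cut c" and t: "t \<in> fst c"
  shows "Ker_minus V \<rho> c t \<subseteq> Ker_plus V \<rho> c t"
proof (cases "snd c = {}")
  case True
  then show ?thesis by (auto simp: Ker_minus_def Ker_plus_def Ker_def)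
next
  case False
  have "Ker V \<rho> r t \<subseteq> Ker V \<rho> r' t" if "r \<in> fst c" "r' \<in> snd c" "t \<le> r" for r r'
    using that c unfolding is_cut_def by (intro Ker_mono) (auto simp: less_imp_le)
  with False show ?thesis by (force simp: Ker_minus_def Ker_plus_def)
qed

text \<open>If an index \<open>s\<close> separates the two cuts, the single subspace \<open>Im V \<rho> t s\<close> lies between the two
  limiting ones; the same holds for kernels in the next lemma. These are the comparisons that make
  the filtrations by cuts into chains.\<close>

lemma Im_plus_subset_Im_minus:
  assumes "is_cut d" "t \<in> snd d" "s \<in> snd c" "s \<in> fst d"
  shows "Im_plus V \<rho> c t \<subseteq> Im_minus V \<rho> d t"
  using assms unfolding Im_plus_def Im_minus_def is_cut_def by (auto simp: less_imp_le)

lemma Ker_plus_subset_Ker_minus: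
  assumes "is_cut c" "t \<in> fst c" "r \<in> snd c" "r \<in> fst d"
  shows "Ker_plus V \<rho> c t \<subseteq> Ker_minus V \<rho> d t"
  using assms unfolding Ker_plus_def Ker_minus_def is_cut_def by (auto simp: less_imp_le)

lemma image_Im_minus:
  assumes c: "is_cut c" and s: "s \<in> snd c" and "s \<le> t"
  shows "\<rho> t s ` Im_minus V \<rho> c s = Im_minus V \<rho> c t"
proof -
  have "\<rho> t s ` Im V \<rho> s r = Im V \<rho> t r" if "r \<in> fst c" for r
    using that c s \<open>s \<le> t\<close> unfolding is_cut_def by (intro image_Im) (auto simp: less_imp_le)
  then show ?thesis
    using \<rho>_zero[OF \<open>s \<le> t\<close>] by (simp add: Im_minus_def image_UN)
qed

lemma image_Im_plus_subset:
  assumes s: "s \<in> snd c" and "s \<le> t"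
  shows "\<rho> t s ` Im_plus V \<rho> c s \<subseteq> Im_plus V \<rho> c t"
proof
  fix y assume "y \<in> \<rho> t s ` Im_plus V \<rho> c s"
  then obtain x where x: "x \<in> Im_plus V \<rho> c s" "y = \<rho> t s x" by blast
  have "y \<in> Im V \<rho> t r" if r: "r \<in> snd c" "r \<le> t" for r
  proof (cases "r \<le> s")
    case True
    then have "x \<in> Im V \<rho> s r" using x(1) r(1) by (auto simp: Im_plus_def)
    then show ?thesis using x(2) image_Im[OF True \<open>s \<le> t\<close>] by blast
  next
    case False
    then have "y = \<rho> t r (\<rho> r s x)" "\<rho> r s x \<in> V r"
      using x Im_plus_subset_V[OF s] \<rho>_comp[of s r t x] \<rho>_closed[of s r x] r(2) by auto
    then show ?thesis using \<rho>_in_Im r(2) by blast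
  qed
  then show "y \<in> Im_plus V \<rho> c t" by (auto simp: Im_plus_def)
qed

lemma \<rho>_in_Ker_plus_iff:
  assumes c: "is_cut c" and t: "t \<in> fst c" and "s \<le> t" and x: "x \<in> V s"
  shows "\<rho> t s x \<in> Ker_plus V \<rho> c t \<longleftrightarrow> x \<in> Ker_plus V \<rho> c s"
proof (cases "snd c = {}")
  case True
  then show ?thesis using \<rho>_closed[OF \<open>s \<le> t\<close> x] x by (simp add: Ker_plus_def)
next
  case False
  have "\<rho> t s x \<in> Ker V \<rho> r t \<longleftrightarrow> x \<in> Ker V \<rho> r s" if "r \<in> snd c" for r
    using that c t x \<open>s \<le> t\<close> unfolding is_cut_def by (intro \<rho>_in_Ker_iff) (auto simp: less_imp_le)
  with False show ?thesis by (simp add: Ker_plus_def)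
qed

text \<open>A vector over \<open>s\<close> that dies between \<open>s\<close> and \<open>t\<close> has image zero, which is in every kernel at \<open>t\<close>.
  The index at which it dies may thus be moved up to \<open>t\<close>, which is still on the lower side of the cut.\<close>

lemma \<rho>_in_Ker_minus_iff:
  assumes t: "t \<in> fst c" and "s \<le> t" and x: "x \<in> V s"
  shows "\<rho> t s x \<in> Ker_minus V \<rho> c t \<longleftrightarrow> x \<in> Ker_minus V \<rho> c s"
proof
  assume "\<rho> t s x \<in> Ker_minus V \<rho> c t"
  then show "x \<in> Ker_minus V \<rho> c s"
    using \<rho>_in_Ker_iff[OF \<open>s \<le> t\<close> _ x] \<open>s \<le> t\<close> by (force simp: Ker_minus_def)
next
  assume "x \<in> Ker_minus V \<rho> c s"
  then obtain r where r: "r \<in> fst c" "s \<le> r" "x \<in> Ker V \<rho> r s"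
    by (auto simp: Ker_minus_def)
  then have "x \<in> Ker V \<rho> (max r t) s" "max r t \<in> fst c" "t \<le> max r t"
    using Ker_mono[of s r "max r t"] t by (auto simp: max_def)
  then show "\<rho> t s x \<in> Ker_minus V \<rho> c t"
    using \<rho>_in_Ker_iff[OF \<open>s \<le> t\<close> _ x, of "max r t"] unfolding Ker_minus_def by blast
qed

end

locale dcc_persistence_module = persistence_module scale V \<rho>
  for scale :: "'k::field \<Rightarrow> 'v::ab_group_add \<Rightarrow> 'v"
    and V :: "'r::linorder \<Rightarrow> 'v set" and \<rho> :: "'r \<Rightarrow> 'r \<Rightarrow> 'v \<Rightarrow> 'v" +
  assumes dcc: "dcc_images_kernels V \<rho>"
begin

text \<open>If the intersection were not attained, every image over the upper part of the cut would
  contain a strictly smaller one further down, and a descending chain that never stabilizes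
  could be chosen.\<close>

lemma Im_plus_attained:
  assumes t: "t \<in> snd c"
  obtains s where "s \<in> snd c" "s \<le> t" "Im_plus V \<rho> c t = Im V \<rho> t s"
proof (rule ccontr)
  assume "\<not> thesis"
  with that have no: "Im_plus V \<rho> c t \<noteq> Im V \<rho> t s" if "s \<in> snd c" "s \<le> t" for s
    using that by blast
  have step: "\<exists>s'. (s' \<in> snd c \<and> s' \<le> t) \<and> s' < s \<and> Im V \<rho> t s' \<noteq> Im V \<rho> t s"
    if s: "s \<in> snd c \<and> s \<le> t" for s
  proof -
    have "Im_plus V \<rho> c t \<subseteq> Im V \<rho> t s"
      using s unfolding Im_plus_def by blast
    then obtain x where x: "x \<in> Im V \<rho> t s" "x \<notin> Im_plus V \<rho> c t"
      using no s by blast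
    then obtain s' where s': "s' \<in> snd c" "s' \<le> t" "x \<notin> Im V \<rho> t s'"
      by (auto simp: Im_plus_def)
    moreover have "s' < s"
      using x(1) s'(2,3) Im_mono[of s s' t] by (meson in_mono not_le)
    ultimately show ?thesis using x(1) by blast
  qed
  obtain f where f: "\<And>n. (f n \<in> snd c \<and> f n \<le> t) \<and> f (Suc n) < f n \<and> Im V \<rho> t (f (Suc n)) \<noteq> Im V \<rho> t (f n)"
    using dependent_nat_choice[of "\<lambda>_ s. s \<in> snd c \<and> s \<le> t" "\<lambda>_ s s'. s' < s \<and> Im V \<rho> t s' \<noteq> Im V \<rho> t s"]
      step t by auto
  then have "\<exists>N. \<forall>n\<ge>N. Im V \<rho> t (f n) = Im V \<rho> t (f N)"
    by (intro dcc[unfolded dcc_images_kernels_def, THEN conjunct1, rule_format]) simp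
  then show False
    using f by (meson lessI less_imp_le)
qed

lemma Ker_plus_attained:
  assumes c: "is_cut c" and t: "t \<in> fst c" and ne: "snd c \<noteq> {}"
  obtains r where "r \<in> snd c" "Ker_plus V \<rho> c t = Ker V \<rho> r t"
proof (rule ccontr)
  assume "\<not> thesis"
  with that have no: "Ker_plus V \<rho> c t \<noteq> Ker V \<rho> r t" if "r \<in> snd c" for r
    using that by blast
  have le: "t \<le> r" if "r \<in> snd c" for r
    using that c t unfolding is_cut_def by (auto simp: less_imp_le)
  have step: "\<exists>r'. r' \<in> snd c \<and> r' < r \<and> Ker V \<rho> r' t \<noteq> Ker V \<rho> r t" if r: "r \<in> snd c" for r
  proof -
    have "Ker_plus V \<rho> c t \<subseteq> Ker V \<rho> r t"
      using r unfolding Ker_plus_def by auto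
    then obtain x where x: "x \<in> Ker V \<rho> r t" "x \<notin> Ker_plus V \<rho> c t"
      using no r by blast
    then obtain r' where r': "r' \<in> snd c" "x \<notin> Ker V \<rho> r' t"
      using ne by (auto simp: Ker_plus_def)
    moreover have "r' < r"
      using x(1) r' le[OF r] Ker_mono[of t r r'] by (meson in_mono not_le)
    ultimately show ?thesis using x(1) by blast
  qed
  obtain f where f: "\<And>n. f n \<in> snd c \<and> f (Suc n) < f n \<and> Ker V \<rho> (f (Suc n)) t \<noteq> Ker V \<rho> (f n) t"
    using dependent_nat_choice[of "\<lambda>_ r. r \<in> snd c" "\<lambda>_ r r'. r' < r \<and> Ker V \<rho> r' t \<noteq> Ker V \<rho> r t"]
      step ne by auto
  then have "\<exists>N. \<forall>n\<ge>N. Ker V \<rho> (f n) t = Ker V \<rho> (f N) t"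
    using dcc le unfolding dcc_images_kernels_def by blast
  then show False
    using f by (meson lessI less_imp_le)
qed

text \<open>Forming images does not commute with infinite intersections; surjectivity holds here
  because the intersection over \<open>s\<close> is attained by a single image.\<close>

lemma image_Im_plus:
  assumes c: "is_cut c" and s: "s \<in> snd c" and "s \<le> t"
  shows "\<rho> t s ` Im_plus V \<rho> c s = Im_plus V \<rho> c t"
proof
  obtain r where r: "r \<in> snd c" "r \<le> s" "Im_plus V \<rho> c s = Im V \<rho> s r"
    using Im_plus_attained[OF s] .
  then have "Im_plus V \<rho> c t \<subseteq> Im V \<rho> t r"
    using \<open>s \<le> t\<close> by (auto simp: Im_plus_def)
  then show "Im_plus V \<rho> c t \<subseteq> \<rho> t s ` Im_plus V \<rho> c s"
    using image_Im[OF r(2) \<open>s \<le> t\<close>] r(3) by simp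
qed (rule image_Im_plus_subset[OF s \<open>s \<le> t\<close>])

end

section \<open>The subquotient of an interval\<close>

context persistence_module
begin

lemma mem_cuts:
  assumes "t \<in> I"
  shows "t \<in> snd (lower_cut I)" "t \<in> fst (upper_cut I)"
  using assms by (auto simp: lower_cut_def upper_cut_def)

lemma subspace_V_plus_at: "t \<in> I \<Longrightarrow> subspace (V_plus_at V \<rho> I t)"
  unfolding V_plus_at_def
  by (intro subspace_inter subspace_Im_plus subspace_Ker_plus is_cut_upper_cut mem_cuts)

lemma subspace_V_minus_at: "t \<in> I \<Longrightarrow> subspace (V_minus_at V \<rho> I t)"
  unfolding V_minus_at_def
  by (intro subspace_set_plus subspace_inter subspace_Im_plus subspace_Im_minus subspace_Ker_plus
      subspace_Ker_minus is_cut_lower_cut is_cut_upper_cut mem_cuts)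

lemma V_plus_at_subset_V: "t \<in> I \<Longrightarrow> V_plus_at V \<rho> I t \<subseteq> V t"
  unfolding V_plus_at_def using Im_plus_subset_V[OF mem_cuts(1)] by blast

text \<open>Compatible families live in the space of all functions on the index set.\<close>
sublocale families: vector_space "pointwise_scale scale :: 'k \<Rightarrow> ('r \<Rightarrow> 'v) \<Rightarrow> 'r \<Rightarrow> 'v"
  by unfold_locales
    (simp_all add: pointwise_scale_def fun_eq_iff scale_right_distrib scale_left_distrib)

lemma sum_pointwise_scale_apply:
  "(\<Sum>i\<in>S. pointwise_scale scale (c i) (g i)) t = (\<Sum>i\<in>S. scale (c i) (g i t))"
  by (induction S rule: infinite_finite_induct) (simp_all add: pointwise_scale_def)

lemma V_plusD:
  assumes "x \<in> V_plus V \<rho> I"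
  shows "t \<in> I \<Longrightarrow> x t \<in> V_plus_at V \<rho> I t" and "t \<notin> I \<Longrightarrow> x t = 0"
    and "s \<in> I \<Longrightarrow> t \<in> I \<Longrightarrow> s \<le> t \<Longrightarrow> \<rho> t s (x s) = x t"
  using assms by (auto simp: V_plus_def inverse_limit_def)

lemma nested_limits:
  "nested_subspaces (pointwise_scale scale) (V_plus V \<rho> I) (V_minus V \<rho> I)"
proof
  note [simp] = pointwise_scale_def
  have V: "x t \<in> V t" if "x \<in> V_plus V \<rho> I" "t \<in> I" for x t
    using V_plusD(1)[OF that] V_plus_at_subset_V[OF that(2)] by blast
  show P: "families.subspace (V_plus V \<rho> I)"
  proof (rule families.subspaceI)
    show "0 \<in> V_plus V \<rho> I"
      using subspace_0[OF subspace_V_plus_at] \<rho>_zero by (simp add: V_plus_def inverse_limit_def)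
    show "x + y \<in> V_plus V \<rho> I" if "x \<in> V_plus V \<rho> I" "y \<in> V_plus V \<rho> I" for x y
      using V_plusD[OF that(1)] V_plusD[OF that(2)] V[OF that(1)] V[OF that(2)]
      by (simp add: V_plus_def inverse_limit_def \<rho>_add subspace_add[OF subspace_V_plus_at])
    show "pointwise_scale scale a x \<in> V_plus V \<rho> I" if "x \<in> V_plus V \<rho> I" for a x
      using V_plusD[OF that] V[OF that]
      by (simp add: V_plus_def inverse_limit_def \<rho>_scale subspace_scale[OF subspace_V_plus_at])
  qed
  show "families.subspace (V_minus V \<rho> I)"
    unfolding V_minus_def
    by (rule families.subspaceI)
      (auto intro: families.subspace_0[OF P] families.subspace_add[OF P]
        families.subspace_scale[OF P, unfolded pointwise_scale_def] subspace_0[OF subspace_V_minus_at] subspace_add[OF subspace_V_minus_at]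
        subspace_scale[OF subspace_V_minus_at])
  show "V_minus V \<rho> I \<subseteq> V_plus V \<rho> I"
    by (auto simp: V_minus_def)
qed

end

context dcc_persistence_module
begin

lemma image_Int_Ker:
  assumes "\<rho> t s ` A' = A" "A' \<subseteq> V s" "\<And>x. x \<in> V s \<Longrightarrow> \<rho> t s x \<in> K \<longleftrightarrow> x \<in> K'"
  shows "\<rho> t s ` (A' \<inter> K') = A \<inter> K"
  using assms by blast

lemma image_V_plus_at:
  assumes "s \<in> I" "t \<in> I" "s \<le> t"
  shows "\<rho> t s ` V_plus_at V \<rho> I s = V_plus_at V \<rho> I t"
  unfolding V_plus_at_def
  using assms is_cut_lower_cut is_cut_upper_cut
  by (intro image_Int_Ker image_Im_plus Im_plus_subset_V \<rho>_in_Ker_plus_iff mem_cuts)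

text \<open>The map between the subquotients is injective: if \<open>\<rho> x = a + b\<close> with \<open>a\<close> and \<open>b\<close> in the
  two parts of \<open>V_minus_at\<close>, lift \<open>a\<close> and \<open>b\<close> to the same parts over \<open>s\<close>; the difference of
  \<open>x\<close> and the lifts dies before the upper end of \<open>I\<close>, so it is again in the second part.\<close>

lemma \<rho>_in_V_minus_at_iff:
  assumes I: "s \<in> I" "t \<in> I" and st: "s \<le> t" and x: "x \<in> V_plus_at V \<rho> I s"
  shows "\<rho> t s x \<in> V_minus_at V \<rho> I t \<longleftrightarrow> x \<in> V_minus_at V \<rho> I s"
proof -
  let ?l = "lower_cut I" and ?u = "upper_cut I"
  have cuts: "s \<in> snd ?l" "t \<in> snd ?l" "s \<in> fst ?u" "t \<in> fst ?u"
    using I mem_cuts by auto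
  note is_cut = is_cut_lower_cut[of I] is_cut_upper_cut[of I]
  have ImV: "Im_minus V \<rho> ?l s \<subseteq> V s" "Im_plus V \<rho> ?l s \<subseteq> V s"
    using Im_minus_subset_Im_plus[OF is_cut(1) cuts(1)] Im_plus_subset_V[OF cuts(1)] by auto
  have first: "\<rho> t s ` (Im_minus V \<rho> ?l s \<inter> Ker_plus V \<rho> ?u s) = Im_minus V \<rho> ?l t \<inter> Ker_plus V \<rho> ?u t"
    using is_cut cuts ImV st by (intro image_Int_Ker image_Im_minus \<rho>_in_Ker_plus_iff)
  have second: "\<rho> t s ` (Im_plus V \<rho> ?l s \<inter> Ker_minus V \<rho> ?u s) = Im_plus V \<rho> ?l t \<inter> Ker_minus V \<rho> ?u t"
    using is_cut cuts ImV st by (intro image_Int_Ker image_Im_plus \<rho>_in_Ker_minus_iff)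
  show ?thesis
  proof
    assume "x \<in> V_minus_at V \<rho> I s"
    then obtain a b where ab: "x = a + b" "a \<in> Im_minus V \<rho> ?l s \<inter> Ker_plus V \<rho> ?u s"
        "b \<in> Im_plus V \<rho> ?l s \<inter> Ker_minus V \<rho> ?u s"
      unfolding V_minus_at_def by (auto elim!: set_plus_elim)
    have "\<rho> t s x = \<rho> t s a + \<rho> t s b"
      using ab ImV by (auto intro: \<rho>_add[OF st])
    then show "\<rho> t s x \<in> V_minus_at V \<rho> I t"
      using ab first second unfolding V_minus_at_def by (metis imageI set_plus_intro)
  next
    assume "\<rho> t s x \<in> V_minus_at V \<rho> I t"
    then obtain a b where ab: "a \<in> Im_minus V \<rho> ?l s \<inter> Ker_plus V \<rho> ?u s"
        "b \<in> Im_plus V \<rho> ?l s \<inter> Ker_minus V \<rho> ?u s" "\<rho> t s x = \<rho> t s a + \<rho> t s b"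
      unfolding V_minus_at_def first[symmetric] second[symmetric] by (auto elim!: set_plus_elim)
    have aP: "a \<in> Im_plus V \<rho> ?l s"
      using ab(1) Im_minus_subset_Im_plus[OF is_cut(1) cuts(1)] by blast
    have inV: "x \<in> V s" "a \<in> V s" "b \<in> V s"
      using ab x V_plus_at_subset_V[OF I(1)] ImV by auto
    have xP: "x \<in> Im_plus V \<rho> ?l s"
      using x by (simp add: V_plus_at_def)
    define k where "k = x - a - b"
    have kP: "k \<in> Im_plus V \<rho> ?l s"
      unfolding k_def using subspace_diff[OF subspace_Im_plus] xP aP ab(2) by blast
    have "\<rho> t s k = 0"
      unfolding k_def using \<rho>_diff[OF st] inV subspace_diff[OF subspace_V] ab(3) by simp
    then have "k \<in> Ker V \<rho> t s"
      using kP ImV by (auto simp: Ker_def)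
    then have "k \<in> Ker_minus V \<rho> ?u s"
      using cuts(4) st by (auto simp: Ker_minus_def)
    then have "b + k \<in> Im_plus V \<rho> ?l s \<inter> Ker_minus V \<rho> ?u s"
      using ab(2) kP subspace_add[OF subspace_Im_plus] subspace_add[OF subspace_Ker_minus[OF cuts(3)]]
      by blast
    then have "a + (b + k) \<in> V_minus_at V \<rho> I s"
      unfolding V_minus_at_def using ab(1) by (rule set_plus_intro[rotated])
    then show "x \<in> V_minus_at V \<rho> I s"
      by (simp add: k_def)
  qed
qed

text \<open>Any two elements of \<open>I\<close> are comparable, and membership in \<open>V_minus_at\<close> passes both up and down
  along the map between them.\<close>

lemma V_minus_iff:
  assumes x: "x \<in> V_plus V \<rho> I" and t: "t \<in> I"
  shows "x \<in> V_minus V \<rho> I \<longleftrightarrow> x t \<in> V_minus_at V \<rho> I t"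
proof
  assume xt: "x t \<in> V_minus_at V \<rho> I t"
  have "x s \<in> V_minus_at V \<rho> I s" if s: "s \<in> I" for s
  proof (cases "s \<le> t")
    case True
    then show ?thesis
      using \<rho>_in_V_minus_at_iff[OF s t True V_plusD(1)[OF x s]] V_plusD(3)[OF x s t True] xt by simp
  next
    case False
    then have "t \<le> s" by simp
    then show ?thesis
      using \<rho>_in_V_minus_at_iff[OF t s _ V_plusD(1)[OF x t]] V_plusD(3)[OF x t s] xt by simp
  qed
  with x show "x \<in> V_minus V \<rho> I"
    by (simp add: V_minus_def)
qed (use t in \<open>simp add: V_minus_def\<close>)

text \<open>The Mittag-Leffler argument: the maps between the spaces \<open>V_plus_at\<close> are surjective, so an
  element lifts step by step along a sequence running down to the lower end of \<open>I\<close>.\<close>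

lemma V_plus_lift:
  assumes C: "countable C" "C \<subseteq> I" "\<And>t. t \<in> I \<Longrightarrow> \<exists>s\<in>C. s \<le> t"
    and t: "t \<in> I" and x: "x \<in> V_plus_at V \<rho> I t"
  shows "\<exists>y\<in>V_plus V \<rho> I. y t = x"
proof -
  have "C \<noteq> {}" using C(3) t by blast
  define e where "e = from_nat_into C"
  have e: "range e = C"
    unfolding e_def using \<open>C \<noteq> {}\<close> C(1) by simp
  (* Running minima of an enumeration of C: a weakly decreasing sequence from t that gets below
     every element of I. *)
  define s where "s = rec_nat t (\<lambda>n r. min r (e n))"
  have s0: "s 0 = t" and sSuc: "s (Suc n) = min (s n) (e n)" for n
    by (simp_all add: s_def)
  have sI: "s n \<in> I" for n
    using t e C(2) by (induction n) (auto simp: s0 sSuc min_def)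
  have dec: "s m \<le> s n" if "n \<le> m" for n m
    by (rule lift_Suc_antimono_le[OF _ that]) (simp add: sSuc)
  have coinitial: "\<exists>n. s n \<le> r" if "r \<in> I" for r
    using C(3)[OF that] e sSuc by (metis imageE min.cobounded2 order_trans)
  have "\<exists>z. (z \<in> V_plus_at V \<rho> I (s (Suc n)) \<and> (Suc n = 0 \<longrightarrow> z = x)) \<and> \<rho> (s n) (s (Suc n)) z = y"
    if "y \<in> V_plus_at V \<rho> I (s n) \<and> (n = 0 \<longrightarrow> y = x)" for n y
  proof -
    have "y \<in> \<rho> (s n) (s (Suc n)) ` V_plus_at V \<rho> I (s (Suc n))"
      using image_V_plus_at[OF sI sI dec, of n "Suc n"] that by simp
    then show ?thesis by auto
  qed
  then obtain w where w: "\<And>n. w n \<in> V_plus_at V \<rho> I (s n)" "w 0 = x"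
      "\<And>n. \<rho> (s n) (s (Suc n)) (w (Suc n)) = w n"
    using dependent_nat_choice[of "\<lambda>n y. y \<in> V_plus_at V \<rho> I (s n) \<and> (n = 0 \<longrightarrow> y = x)"
        "\<lambda>n y z. \<rho> (s n) (s (Suc n)) z = y"] x s0 by auto
  have wV: "w n \<in> V (s n)" for n
    using w(1) V_plus_at_subset_V[OF sI] by blast
  have w_le: "\<rho> (s n) (s m) (w m) = w n" if "n \<le> m" for n m
    using that
  proof (induction m rule: dec_induct)
    case base
    show ?case using \<rho>_id[OF wV] .
  next
    case (step m)
    then show ?case
      using \<rho>_comp[OF dec[of m "Suc m"] dec[of n m] wV] w(3) by simp
  qed
  (* The value at r may be computed from any term of the sequence below r, so the choice of the
     first one is immaterial. *)
  define y where "y r = (if r \<in> I then \<rho> r (s (LEAST n. s n \<le> r)) (w (LEAST n. s n \<le> r)) else 0)" for r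
  have y: "y r = \<rho> r (s n) (w n)" if r: "r \<in> I" "s n \<le> r" for r n
  proof -
    let ?m = "LEAST n. s n \<le> r"
    have "?m \<le> n" using r(2) by (rule Least_le)
    moreover have "s ?m \<le> r" using r(2) by (rule LeastI)
    ultimately have "\<rho> r (s n) (w n) = \<rho> r (s ?m) (w ?m)"
      using \<rho>_comp[OF dec[of ?m n] _ wV, of r] w_le by simp
    then show ?thesis using r(1) by (simp add: y_def)
  qed
  show ?thesis
  proof
    show "y \<in> V_plus V \<rho> I"
      unfolding V_plus_def inverse_limit_def
    proof (intro CollectI conjI ballI allI impI)
      fix r assume r: "r \<in> I"
      then obtain n where n: "s n \<le> r" using coinitial by blast
      then show "y r \<in> V_plus_at V \<rho> I r"
        using y[OF r n] image_V_plus_at[OF sI r n] w(1) by blast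
      fix r' assume r': "r' \<in> I" "r \<le> r'"
      then show "\<rho> r' r (y r) = y r'"
        using y[OF r n] y[OF r'(1), of n] n \<rho>_comp[OF n r'(2) wV] by simp
    qed (simp add: y_def)
    show "y t = x"
      using y[OF t, of 0] \<rho>_id wV[of 0] by (simp add: s0 w(2))
  qed
qed

end

section \<open>The filtration of a vector space by intervals\<close>

lemma cuts_differ:
  assumes "is_cut c" "is_cut d" "c \<noteq> d"
  obtains s where "s \<in> snd c" "s \<in> fst d" | s where "s \<in> snd d" "s \<in> fst c"
proof -
  have "snd c = - fst c" "snd d = - fst d"
    using assms(1,2) unfolding is_cut_def by (auto simp: set_eq_iff)
  moreover from this have "fst c \<noteq> fst d"
    using assms(3) by (auto simp: prod_eq_iff)
  ultimately show thesis
    using that by blast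
qed

text \<open>The intervals containing \<open>t\<close> correspond to the pairs of cuts with \<open>t\<close> above the first and below
  the second, so an interval may be constructed by choosing its two ends separately.\<close>

lemma interval_of_cuts:
  assumes c: "is_cut c" and d: "is_cut d" and t: "t \<in> snd c" "t \<in> fst d"
  shows "order_interval (snd c \<inter> fst d)" and "lower_cut (snd c \<inter> fst d) = c"
    and "upper_cut (snd c \<inter> fst d) = d"
proof -
  have c': "snd c = - fst c" and d': "snd d = - fst d"
    using assms(1,2) unfolding is_cut_def by (auto simp: set_eq_iff)
  have up: "s \<in> snd c" if "r \<in> snd c" "r \<le> s" for r s
    using c that unfolding is_cut_def c' by (metis ComplI UnE leD)
  have down: "r \<in> fst d" if "s \<in> fst d" "r \<le> s" for r s
    using d that unfolding is_cut_def by (metis UNIV_I UnE leD)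
  show "order_interval (snd c \<inter> fst d)"
    unfolding order_interval_def using t up down by blast
  have low: "(\<exists>s\<in>snd c \<inter> fst d. s \<le> x) \<longleftrightarrow> x \<in> snd c" for x
    using t up down by (metis IntE IntI le_cases order_refl)
  have upp: "(\<exists>s\<in>snd c \<inter> fst d. x \<le> s) \<longleftrightarrow> x \<in> fst d" for x
    using t up down by (metis IntE IntI le_cases order_refl)
  show "lower_cut (snd c \<inter> fst d) = c"
    using low by (auto simp: lower_cut_def prod_eq_iff c' set_eq_iff not_less[symmetric])
  show "upper_cut (snd c \<inter> fst d) = d"
    using upp by (auto simp: upper_cut_def prod_eq_iff d' set_eq_iff not_less[symmetric])
qed

text \<open>Comparability gives no order on the index set itself, since sections with \<open>Fm i = Fp i\<close> may
  compare both ways. Adding one index at a time, either the old dominating section stays, or the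
  new one contains it and then contains everything that it dominated.\<close>

lemma exists_dominating_section:
  assumes "finite S" "S \<noteq> {}" and "\<And>i. i \<in> S \<Longrightarrow> Fm i \<subseteq> Fp i"
    and "\<And>i j. i \<in> S \<Longrightarrow> j \<in> S \<Longrightarrow> i \<noteq> j \<Longrightarrow> Fp i \<subseteq> Fm j \<or> Fp j \<subseteq> Fm i"
  shows "\<exists>i\<in>S. \<forall>j\<in>S. j \<noteq> i \<longrightarrow> Fp j \<subseteq> Fm i"
  using assms
proof (induction S rule: finite_ne_induct)
  case (insert k S)
  then obtain i where i: "i \<in> S" "\<forall>j\<in>S. j \<noteq> i \<longrightarrow> Fp j \<subseteq> Fm i"
    by auto
  have "i \<noteq> k" using i(1) insert.hyps by auto
  with insert.prems(2)[of i k] i(1) consider "Fp k \<subseteq> Fm i" | "Fp i \<subseteq> Fm k" by auto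
  then show ?case
  proof cases
    case 1
    with i show ?thesis by auto
  next
    case 2
    have "Fp j \<subseteq> Fm k" if "j \<in> S" for j
      using 2 i that insert.prems(1)[of i] by (cases "j = i") auto
    then show ?thesis by auto
  qed
qed simp

context persistence_module
begin

text \<open>The lexicographic refinement of the image filtration by the kernel filtration: between
  consecutive images, the steps are those cut out by the kernels. Unlike the spaces
  \<open>V_minus_at\<close> and \<open>V_plus_at\<close>, which have the same quotients, these pairs are linearly arranged.\<close>

definition section_minus :: "'r set \<Rightarrow> 'r \<Rightarrow> 'v set" where
  "section_minus I t = Im_minus V \<rho> (lower_cut I) t +
     (Im_plus V \<rho> (lower_cut I) t \<inter> Ker_minus V \<rho> (upper_cut I) t)"

definition section_plus :: "'r set \<Rightarrow> 'r \<Rightarrow> 'v set" where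
  "section_plus I t = Im_minus V \<rho> (lower_cut I) t + V_plus_at V \<rho> I t"

lemma subspace_section_minus: "t \<in> I \<Longrightarrow> subspace (section_minus I t)"
  unfolding section_minus_def
  by (intro subspace_set_plus subspace_inter subspace_Im_plus subspace_Im_minus
      subspace_Ker_minus is_cut_lower_cut mem_cuts)

lemma section_minus_subset_section_plus:
  assumes "t \<in> I"
  shows "section_minus I t \<subseteq> section_plus I t"
  unfolding section_minus_def section_plus_def V_plus_at_def
  using Ker_minus_subset_Ker_plus[OF is_cut_upper_cut mem_cuts(2)[OF assms]]
  by (intro set_plus_mono2) auto

lemma V_plus_at_subset_section_plus:
  assumes "t \<in> I"
  shows "V_plus_at V \<rho> I t \<subseteq> section_plus I t"
  unfolding section_plus_def
  using subspace_0[OF subspace_Im_minus[OF is_cut_lower_cut mem_cuts(1)[OF assms]]]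
  by (rule set_zero_plus2)

text \<open>The modular law: the kernel part of a vector of \<open>section_minus\<close> is already in \<open>Ker_plus\<close>, so
  for a vector of \<open>V_plus_at\<close> the image part is in \<open>Ker_plus\<close> as well.\<close>

lemma V_plus_at_Int_section_minus:
  assumes t: "t \<in> I" and x: "x \<in> V_plus_at V \<rho> I t" "x \<in> section_minus I t"
  shows "x \<in> V_minus_at V \<rho> I t"
proof -
  obtain a b where ab: "x = a + b" "a \<in> Im_minus V \<rho> (lower_cut I) t"
      "b \<in> Im_plus V \<rho> (lower_cut I) t \<inter> Ker_minus V \<rho> (upper_cut I) t"
    using x(2) unfolding section_minus_def by (auto elim!: set_plus_elim)
  have K: "subspace (Ker_plus V \<rho> (upper_cut I) t)"
    by (rule subspace_Ker_plus[OF is_cut_upper_cut mem_cuts(2)[OF t]])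
  have "b \<in> Ker_plus V \<rho> (upper_cut I) t"
    using ab(3) Ker_minus_subset_Ker_plus[OF is_cut_upper_cut mem_cuts(2)[OF t]] by blast
  moreover have "x \<in> Ker_plus V \<rho> (upper_cut I) t"
    using x(1) by (simp add: V_plus_at_def)
  ultimately have "a \<in> Ker_plus V \<rho> (upper_cut I) t"
    using subspace_diff[OF K, of x b] ab(1) by simp
  then show ?thesis
    using ab unfolding V_minus_at_def by blast
qed

text \<open>Lexicographic comparison: the lower cuts decide, and the upper cuts decide between intervals
  that have the same lower cut.\<close>

lemma sections_comparable:
  assumes I: "order_interval I" "t \<in> I" and J: "order_interval J" "t \<in> J" and "I \<noteq> J"
  shows "section_plus I t \<subseteq> section_minus J t \<or> section_plus J t \<subseteq> section_minus I t"
proof -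
  have lower: "section_plus I t \<subseteq> section_minus J t"
    if "t \<in> I" "t \<in> J" "s \<in> snd (lower_cut I)" "s \<in> fst (lower_cut J)" for I J s
  proof -
    have "section_plus I t \<subseteq> Im_plus V \<rho> (lower_cut I) t + Im_plus V \<rho> (lower_cut I) t"
      unfolding section_plus_def V_plus_at_def
      using Im_minus_subset_Im_plus[OF is_cut_lower_cut mem_cuts(1)[OF that(1)]]
      by (intro set_plus_mono2) auto
    also have "\<dots> \<subseteq> Im_plus V \<rho> (lower_cut I) t"
      using subspace_add[OF subspace_Im_plus[of "lower_cut I" t]] by (auto elim!: set_plus_elim)
    also have "\<dots> \<subseteq> Im_minus V \<rho> (lower_cut J) t"
      using Im_plus_subset_Im_minus[OF is_cut_lower_cut mem_cuts(1)[OF that(2)] that(3,4)] .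
    also have "\<dots> \<subseteq> section_minus J t"
      unfolding section_minus_def
      using set_zero_plus2[OF subspace_0[OF subspace_inter[OF subspace_Im_plus
            subspace_Ker_minus[OF mem_cuts(2)[OF that(2)]]]]]
      by (simp add: add.commute)
    finally show ?thesis .
  qed
  have upper: "section_plus I t \<subseteq> section_minus J t"
    if "t \<in> I" "t \<in> J" "lower_cut I = lower_cut J" "r \<in> snd (upper_cut I)" "r \<in> fst (upper_cut J)" for I J r
    unfolding section_plus_def section_minus_def V_plus_at_def that(3)
    using Ker_plus_subset_Ker_minus[OF is_cut_upper_cut mem_cuts(2)[OF that(1)] that(4,5)]
    by (intro set_plus_mono2) auto
  show ?thesis
  proof (cases "lower_cut I = lower_cut J")
    case False
    then show ?thesis
      using cuts_differ[OF is_cut_lower_cut is_cut_lower_cut False] lower I(2) J(2) by metis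
  next
    case True
    then have "upper_cut I \<noteq> upper_cut J"
      using interval_eq_cuts[OF I(1)] interval_eq_cuts[OF J(1)] \<open>I \<noteq> J\<close> by auto
    then show ?thesis
      using cuts_differ[OF is_cut_upper_cut is_cut_upper_cut] upper I(2) J(2) True by metis
  qed
qed

end

context dcc_persistence_module
begin

text \<open>A proper subspace \<open>X\<close> of \<open>V t\<close> is detected by some interval. Its lower end is where the
  images at \<open>t\<close> start to leave \<open>X\<close>, and its upper end is where the kernels, cut down to
  the limiting image, start to leave \<open>X\<close>. The chain conditions make the limiting image
  and kernel themselves an image and a kernel, so they really do leave \<open>X\<close>.\<close>

lemma interval_detects_proper_subspace:
  assumes X: "subspace X" "X \<subseteq> V t" "X \<noteq> V t"
  obtains I where "order_interval I" "t \<in> I" "V_minus_at V \<rho> I t \<subseteq> X" "\<not> V_plus_at V \<rho> I t \<subseteq> X"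
proof -
  define A where "A = {s. s \<le> t \<and> Im V \<rho> t s \<subseteq> X}"
  define c where "c = (A, - A)"
  have c: "is_cut c"
    unfolding is_cut_def c_def
  proof (intro conjI ballI)
    fix s s' assume s: "s \<in> fst (A, - A)" "s' \<in> snd (A, - A)"
    show "s < s'"
    proof (rule ccontr)
      assume "\<not> s < s'"
      with s have "s' \<le> s" "s \<le> t" by (auto simp: A_def)
      then have "Im V \<rho> t s' \<subseteq> Im V \<rho> t s" by (rule Im_mono)
      then show False using s \<open>s' \<le> s\<close> \<open>s \<le> t\<close> by (auto simp: A_def)
    qed
  qed auto
  have tc: "t \<in> snd c"
    using X(2,3) by (auto simp: c_def A_def Im_self)
  define E where "E = {r. r < t \<or> Im_plus V \<rho> c t \<inter> Ker V \<rho> r t \<subseteq> X}"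
  define d where "d = (E, - E)"
  have d: "is_cut d"
    unfolding is_cut_def d_def
  proof (intro conjI ballI)
    fix r r' assume r: "r \<in> fst (E, - E)" "r' \<in> snd (E, - E)"
    show "r < r'"
    proof (rule ccontr)
      assume "\<not> r < r'"
      with r have "t \<le> r'" "r' \<le> r" by (auto simp: E_def)
      then have "Ker V \<rho> r' t \<subseteq> Ker V \<rho> r t" by (rule Ker_mono)
      then show False using r \<open>t \<le> r'\<close> \<open>r' \<le> r\<close> by (auto simp: E_def)
    qed
  qed auto
  have "Ker V \<rho> t t \<subseteq> X"
    using \<rho>_id subspace_0[OF X(1)] by (auto simp: Ker_def)
  then have td: "t \<in> fst d"
    by (auto simp: d_def E_def)
  define I where "I = snd c \<inter> fst d"
  have cuts: "lower_cut I = c" "upper_cut I = d"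
    unfolding I_def using interval_of_cuts[OF c d tc td] by auto
  show thesis
  proof
    show "order_interval I" "t \<in> I"
      unfolding I_def using interval_of_cuts[OF c d tc td] tc td by auto
    have "Im_minus V \<rho> c t \<subseteq> X"
      using subspace_0[OF X(1)] by (auto simp: Im_minus_def c_def A_def)
    moreover have "Im_plus V \<rho> c t \<inter> Ker_minus V \<rho> d t \<subseteq> X"
      by (auto simp: Ker_minus_def d_def E_def)
    ultimately show "V_minus_at V \<rho> I t \<subseteq> X"
      unfolding V_minus_at_def cuts using subspace_add[OF X(1)] by (auto elim!: set_plus_elim)
    show "\<not> V_plus_at V \<rho> I t \<subseteq> X"
    proof (cases "snd d = {}")
      case True
      obtain s where "s \<in> snd c" "s \<le> t" "Im_plus V \<rho> c t = Im V \<rho> t s"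
        using Im_plus_attained[OF tc] .
      then have "\<not> Im_plus V \<rho> c t \<subseteq> X" by (simp add: c_def A_def)
      then show ?thesis
        using True Im_plus_subset_V[OF tc] by (auto simp: V_plus_at_def cuts Ker_plus_def)
    next
      case False
      obtain r where "r \<in> snd d" "Ker_plus V \<rho> d t = Ker V \<rho> r t"
        using Ker_plus_attained[OF d td False] .
      then show ?thesis
        by (simp add: V_plus_at_def cuts d_def E_def)
    qed
  qed
qed

end

section \<open>Existence of an interval decomposition\<close>

locale interval_bases = dcc_persistence_module scale V \<rho>
  for scale :: "'k::field \<Rightarrow> 'v::ab_group_add \<Rightarrow> 'v"
    and V :: "'r::linorder \<Rightarrow> 'v set" and \<rho> :: "'r \<Rightarrow> 'r \<Rightarrow> 'v \<Rightarrow> 'v" +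
  fixes B :: "'r set \<Rightarrow> ('r \<Rightarrow> 'v) set"
  assumes lift: "\<lbrakk>order_interval I; t \<in> I; x \<in> V_plus_at V \<rho> I t\<rbrakk> \<Longrightarrow> \<exists>y\<in>V_plus V \<rho> I. y t = x"
    and bases: "nested_subspaces.basis_modulo (pointwise_scale scale) (V_plus V \<rho> I) (V_minus V \<rho> I) (\<lambda>b. b) (B I)"
begin

text \<open>The bases for the different intervals can be merged into one set of families, because a
  basis element vanishes nowhere on its interval and everywhere outside, and so determines it.\<close>

definition generators :: "('r \<Rightarrow> 'v) set" where
  "generators = (\<Union>I\<in>{I. order_interval I}. B I)"

definition support :: "('r \<Rightarrow> 'v) \<Rightarrow> 'r set" where
  "support b = {t. b t \<noteq> 0}"

definition cyclic :: "('r \<Rightarrow> 'v) \<Rightarrow> 'r \<Rightarrow> 'v set" where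
  "cyclic b t = range (\<lambda>a. scale a (b t))"

lemma B_V_plus: "b \<in> B I \<Longrightarrow> b \<in> V_plus V \<rho> I"
  using nested_subspaces.basis_moduloD(1)[OF nested_limits bases] .

text \<open>A basis element is not in \<open>V_minus\<close>, hence at no point of \<open>I\<close> in \<open>V_minus_at\<close>, which contains
  zero.\<close>

lemma B_support:
  assumes b: "b \<in> B I" and "order_interval I"
  shows "support b = I"
proof -
  have "b \<notin> V_minus V \<rho> I"
  proof
    assume "b \<in> V_minus V \<rho> I"
    then have "(1::'k) = 0"
      using nested_subspaces.basis_moduloD(2)[OF nested_limits bases, where S = "{b}" and c = "\<lambda>_. 1" and i = b] b
      by simp
    then show False by simp
  qed
  then have "b t \<noteq> 0" if "t \<in> I" for t
    using V_minus_iff[OF B_V_plus[OF b] that] subspace_0[OF subspace_V_minus_at[OF that]] by auto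
  then show ?thesis
    using V_plusD(2)[OF B_V_plus[OF b]] by (auto simp: support_def)
qed

lemma generatorsD:
  assumes "b \<in> generators"
  shows "order_interval (support b)" "b \<in> B (support b)" "b \<in> V_plus V \<rho> (support b)"
proof -
  obtain I where I: "order_interval I" "b \<in> B I"
    using assms by (auto simp: generators_def)
  then show "order_interval (support b)" "b \<in> B (support b)" "b \<in> V_plus V \<rho> (support b)"
    using B_support B_V_plus by auto
qed

lemma generator_in_V:
  assumes "b \<in> generators"
  shows "b t \<in> V t"
  using V_plusD(1)[OF generatorsD(3)[OF assms], of t] V_plus_at_subset_V[of t "support b"] zero_in_V[of t]
  by (cases "t \<in> support b") (auto simp: support_def)

text \<open>Inside the support this is compatibility of the family. Beyond the upper end of the support,
  the vector dies because \<open>V_plus_at\<close> is contained in \<open>Ker_plus\<close>.\<close>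

lemma \<rho>_generator:
  assumes b: "b \<in> generators" and s: "s \<in> support b" and st: "s \<le> t"
  shows "\<rho> t s (b s) = b t"
proof (cases "t \<in> support b")
  case True
  then show ?thesis using V_plusD(3)[OF generatorsD(3)[OF b] s _ st] by simp
next
  case False
  have "r < t" if "r \<in> support b" for r
    using generatorsD(1)[OF b] s st False that unfolding order_interval_def by (meson not_le)
  then have "t \<in> snd (upper_cut (support b))"
    by (simp add: upper_cut_def)
  moreover have "b s \<in> Ker_plus V \<rho> (upper_cut (support b)) s"
    using V_plusD(1)[OF generatorsD(3)[OF b] s] by (simp add: V_plus_at_def)
  ultimately have "\<rho> t s (b s) = 0"
    by (auto simp: Ker_plus_def Ker_def split: if_splits)
  then show ?thesis using False by (simp add: support_def)
qed

lemma submodule_cyclic: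
  assumes b: "b \<in> generators"
  shows "pmod_submodule scale V \<rho> (cyclic b)"
  unfolding pmod_submodule_def
proof (intro conjI allI impI)
  show "subspace (cyclic b t)" for t
    using subspace_span[of "{b t}"] by (simp add: cyclic_def span_singleton)
  show "cyclic b t \<subseteq> V t" for t
    using subspace_scale[OF subspace_V generator_in_V[OF b]] by (auto simp: cyclic_def)
  show "\<rho> t s ` cyclic b s \<subseteq> cyclic b t" if st: "s \<le> t" for s t
  proof (cases "s \<in> support b")
    case True
    then show ?thesis
      using \<rho>_scale[OF st generator_in_V[OF b]] \<rho>_generator[OF b True st] by (auto simp: cyclic_def)
  next
    case False
    then have "\<rho> t s ` cyclic b s = {scale 0 (b t)}"
      using \<rho>_zero[OF st] by (auto simp: support_def cyclic_def)
    then show ?thesis by (auto simp: cyclic_def)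
  qed
qed

lemma cyclic_iso_interval:
  assumes b: "b \<in> generators"
  shows "iso_interval_module scale (cyclic b) \<rho> (support b)"
proof -
  define f where "f t x = (if t \<in> support b then THE a. x = scale a (b t) else 0)" for t x
  have f: "f t (scale a (b t)) = a" if "t \<in> support b" for t a
    unfolding f_def using that by (simp add: support_def)
  have f0: "f t x = 0" if "t \<notin> support b" for t x
    using that by (simp add: f_def)
  show ?thesis
    unfolding iso_interval_module_def pmod_iso_def
  proof (intro exI[of _ f] conjI allI impI ballI)
    show "linear_between scale (cyclic b t) (*) (interval_space (support b) t) (f t)" for t
      by (cases "t \<in> support b")
        (auto simp: linear_between_def cyclic_def interval_space_def f f0 simp flip: scale_left_distrib)
    show "bij_betw (f t) (cyclic b t) (interval_space (support b) t)" for t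
    proof (cases "t \<in> support b")
      case True
      have "inj_on (f t) (cyclic b t)"
        using True by (auto simp: inj_on_def cyclic_def f)
      moreover have "f t ` cyclic b t = UNIV"
        using f[OF True] by (simp add: cyclic_def image_image)
      ultimately show ?thesis
        using True by (simp add: bij_betw_def interval_space_def)
    next
      case False
      then have "cyclic b t = {0}"
        by (auto simp: cyclic_def support_def)
      then show ?thesis
        using False by (simp add: bij_betw_def interval_space_def f0)
    qed
    fix s t x assume st: "s \<le> t" and "x \<in> cyclic b s"
    then obtain a where a: "x = scale a (b s)" by (auto simp: cyclic_def)
    show "f t (\<rho> t s x) = interval_map (support b) t s (f s x)"
    proof (cases "s \<in> support b \<and> t \<in> support b")
      case True
      then show ?thesis
        using \<rho>_scale[OF st generator_in_V[OF b]] \<rho>_generator[OF b _ st] by (simp add: a interval_map_def f)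
    next
      case False
      moreover have "f t (\<rho> t s x) = 0" if "t \<in> support b" "s \<notin> support b"
        using that \<rho>_zero[OF st] f[OF that(1), of 0] by (simp add: a support_def)
      ultimately have "f t (\<rho> t s x) = 0"
        using f0 by blast
      with False show ?thesis by (auto simp: interval_map_def)
    qed
  qed
qed

text \<open>In a nontrivial relation among generators at \<open>t\<close>, collect the terms whose interval dominates
  the others. Their sum lies in the lower section of that interval, so the
  corresponding combination of limit elements lies in \<open>V_minus\<close>, where the basis admits no relation.\<close>

lemma generators_independent_at:
  assumes S: "finite S" "S \<subseteq> generators" and t: "\<And>b. b \<in> S \<Longrightarrow> t \<in> support b"
    and sum0: "(\<Sum>b\<in>S. scale (c b) (b t)) = 0"
  shows "\<forall>b\<in>S. c b = 0"
proof (rule ccontr)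
  assume nontrivial: "\<not> (\<forall>b\<in>S. c b = 0)"
  define S' where "S' = {b \<in> S. c b \<noteq> 0}"
  have S': "finite S'" "S' \<noteq> {}" "S' \<subseteq> generators" "\<And>b. b \<in> S' \<Longrightarrow> t \<in> support b"
    using nontrivial S t by (auto simp: S'_def)
  have sum0': "(\<Sum>b\<in>S'. scale (c b) (b t)) = 0"
    using sum0 S(1) unfolding S'_def by (subst sum.mono_neutral_left[of S]) auto
  have "\<exists>I\<in>support ` S'. \<forall>J\<in>support ` S'. J \<noteq> I \<longrightarrow> section_plus J t \<subseteq> section_minus I t"
  proof (rule exists_dominating_section)
    fix I assume "I \<in> support ` S'"
    then show "section_minus I t \<subseteq> section_plus I t"
      using S'(4) section_minus_subset_section_plus by blast
    fix J assume "J \<in> support ` S'" "I \<noteq> J"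
    then show "section_plus I t \<subseteq> section_minus J t \<or> section_plus J t \<subseteq> section_minus I t"
      using \<open>I \<in> support ` S'\<close> S'(3,4) generatorsD(1) by (intro sections_comparable) auto
  qed (use S'(1,2) in auto)
  then obtain I where I: "I \<in> support ` S'"
    and dom: "\<And>J. J \<in> support ` S' \<Longrightarrow> J \<noteq> I \<Longrightarrow> section_plus J t \<subseteq> section_minus I t"
    by blast
  have tI: "t \<in> I" using I S'(4) by blast
  define T where "T = {b \<in> S'. support b = I}"
  have T: "finite T" "T \<noteq> {}" "T \<subseteq> B I"
    using S'(1) I S'(3)[THEN subsetD, THEN generatorsD(2)] by (auto simp: T_def) metis
  have in_plus: "scale (c b) (b t) \<in> V_plus_at V \<rho> (support b) t" if "b \<in> S'" for b
    using subspace_scale[OF subspace_V_plus_at] V_plusD(1)[OF generatorsD(3)] S'(3,4) that by blast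
  have "(\<Sum>b\<in>S' - T. scale (c b) (b t)) \<in> section_minus I t"
  proof (rule subspace_sum[OF subspace_section_minus[OF tI]])
    fix b assume "b \<in> S' - T"
    then show "scale (c b) (b t) \<in> section_minus I t"
      using in_plus[of b] V_plus_at_subset_section_plus[of t "support b"] S'(4)[of b] dom[of "support b"]
      by (auto simp: T_def)
  qed
  moreover have "(\<Sum>b\<in>T. scale (c b) (b t)) = - (\<Sum>b\<in>S' - T. scale (c b) (b t))"
    using sum0' S'(1) sum.subset_diff[of T S' "\<lambda>b. scale (c b) (b t)"]
    by (auto simp: T_def eq_neg_iff_add_eq_0 add.commute)
  ultimately have "(\<Sum>b\<in>T. scale (c b) (b t)) \<in> section_minus I t"
    using subspace_neg[OF subspace_section_minus[OF tI]] by simp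
  moreover have "(\<Sum>b\<in>T. scale (c b) (b t)) \<in> V_plus_at V \<rho> I t"
    using in_plus by (intro subspace_sum[OF subspace_V_plus_at[OF tI]]) (auto simp: T_def)
  ultimately have "(\<Sum>b\<in>T. scale (c b) (b t)) \<in> V_minus_at V \<rho> I t"
    using V_plus_at_Int_section_minus[OF tI] by blast
  moreover have "(\<Sum>b\<in>T. pointwise_scale scale (c b) b) \<in> V_plus V \<rho> I"
    using nested_limits[of I] T(3) B_V_plus
    by (intro families.subspace_sum families.subspace_scale) (auto simp: nested_subspaces_def nested_subspaces_axioms_def)
  ultimately have "(\<Sum>b\<in>T. pointwise_scale scale (c b) b) \<in> V_minus V \<rho> I"
    using V_minus_iff[OF _ tI] by (simp add: sum_pointwise_scale_apply)
  then have "c b = 0" if "b \<in> T" for b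
    using nested_subspaces.basis_moduloD(2)[OF nested_limits bases T(1,3)] that by blast
  then show False
    using T(2) by (auto simp: T_def S'_def)
qed

text \<open>If the span were proper, some interval \<open>I\<close> would have \<open>V_minus_at\<close> inside it and \<open>V_plus_at\<close> not. But
  a vector of \<open>V_plus_at\<close> lifts to a compatible family, which is a combination of generators up to
  \<open>V_minus\<close>.\<close>

lemma generators_span_at: "span ((\<lambda>b. b t) ` generators) = V t"
proof (rule ccontr)
  let ?X = "span ((\<lambda>b. b t) ` generators)"
  assume ne: "?X \<noteq> V t"
  have sub: "?X \<subseteq> V t"
    using generator_in_V by (intro span_minimal subspace_V) auto
  obtain I where I: "order_interval I" "t \<in> I" "V_minus_at V \<rho> I t \<subseteq> ?X" "\<not> V_plus_at V \<rho> I t \<subseteq> ?X"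
    using interval_detects_proper_subspace[OF subspace_span sub ne] .
  have "x \<in> ?X" if "x \<in> V_plus_at V \<rho> I t" for x
  proof -
    obtain y where y: "y \<in> V_plus V \<rho> I" "y t = x"
      using lift[OF I(1,2) \<open>x \<in> V_plus_at V \<rho> I t\<close>] by blast
    obtain S c where S: "S \<subseteq> B I" "y - (\<Sum>b\<in>S. pointwise_scale scale (c b) b) \<in> V_minus V \<rho> I"
      using nested_subspaces.basis_moduloD(3)[OF nested_limits bases y(1)] by blast
    then have "x - (\<Sum>b\<in>S. scale (c b) (b t)) \<in> ?X"
      using I(2,3) y(2) by (auto simp: V_minus_def sum_pointwise_scale_apply fun_diff_def)
    moreover have "(\<Sum>b\<in>S. scale (c b) (b t)) \<in> ?X"
      using S(1) I(1) by (intro span_sum span_scale span_base) (auto simp: generators_def)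
    ultimately show ?thesis
      using span_add by fastforce
  qed
  with I(4) show False by blast
qed

lemma inj_cyclic: "inj_on cyclic generators"
proof (rule inj_onI, rule ccontr)
  fix b b' assume b: "b \<in> generators" "b' \<in> generators" and eq: "cyclic b = cyclic b'" and ne: "b \<noteq> b'"
  have "t \<in> support b \<longleftrightarrow> cyclic b t \<noteq> {0}" for b t
  proof
    assume "t \<in> support b"
    then have "b t \<noteq> 0" "b t \<in> cyclic b t"
      by (auto simp: support_def cyclic_def intro: range_eqI[of _ _ 1])
    then show "cyclic b t \<noteq> {0}" by auto
  qed (auto simp: support_def cyclic_def)
  then have support: "support b = support b'"
    using eq by auto
  obtain t where t: "t \<in> support b"
    using generatorsD(1)[OF b(1)] by (auto simp: order_interval_def)
  have "b t \<in> cyclic b' t"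
    unfolding eq[symmetric] by (auto simp: cyclic_def intro: range_eqI[of _ _ 1])
  then obtain a where a: "b t = scale a (b' t)"
    by (auto simp: cyclic_def)
  let ?c = "\<lambda>x. if x = b then 1 else - a"
  have "\<forall>x\<in>{b, b'}. ?c x = 0"
    by (rule generators_independent_at[where t = t]) (use b ne t support a in auto)
  then show False by simp
qed

text \<open>The values at \<open>t\<close> of the generators whose support contains \<open>t\<close> form a basis of \<open>V t\<close>; the other
  generators contribute zero summands at \<open>t\<close> and drop out of all sums.\<close>

lemma decomposition_at:
  "bij_betw (\<lambda>x. \<Sum>M | x M \<noteq> 0. x M) (direct_sum_at (cyclic ` generators) t) (V t)"
  unfolding bij_betw_def
proof
  let ?D = "direct_sum_at (cyclic ` generators) t"
  show "inj_on (\<lambda>x. \<Sum>M | x M \<noteq> 0. x M) ?D"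
  proof (rule inj_onI)
    fix x y assume x: "x \<in> ?D" and y: "y \<in> ?D" and eq: "(\<Sum>M | x M \<noteq> 0. x M) = (\<Sum>M | y M \<noteq> 0. y M)"
    let ?T = "{M. x M \<noteq> 0} \<union> {M. y M \<noteq> 0}"
    have T: "finite ?T" "?T \<subseteq> cyclic ` generators"
      using x y by (auto simp: direct_sum_at_def)
    obtain S where S: "S \<subseteq> generators" "finite S" "?T = cyclic ` S"
      using T by (meson finite_subset_image)
    have "\<exists>c. x (cyclic b) - y (cyclic b) = scale c (b t)" if "b \<in> S" for b
    proof -
      have "x (cyclic b) \<in> cyclic b t" "y (cyclic b) \<in> cyclic b t"
        using x y S(1) that by (auto simp: direct_sum_at_def)
      then show ?thesis
        by (auto simp: cyclic_def simp flip: scale_left_diff_distrib)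
    qed
    then obtain c where c: "\<And>b. b \<in> S \<Longrightarrow> x (cyclic b) - y (cyclic b) = scale (c b) (b t)"
      by metis
    have "(\<Sum>M | x M \<noteq> 0. x M) = (\<Sum>M\<in>?T. x M)" "(\<Sum>M | y M \<noteq> 0. y M) = (\<Sum>M\<in>?T. y M)"
      using T(1) by (auto intro!: sum.mono_neutral_left)
    then have "0 = (\<Sum>M\<in>?T. x M - y M)"
      using eq by (simp add: sum_subtractf)
    also have "\<dots> = (\<Sum>b\<in>S. scale (c b) (b t))"
      unfolding S(3) using c by (simp add: sum.reindex[OF inj_on_subset[OF inj_cyclic S(1)]])
    also have "\<dots> = (\<Sum>b\<in>{b \<in> S. t \<in> support b}. scale (c b) (b t))"
      using S(2) by (intro sum.mono_neutral_right) (auto simp: support_def)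
    finally have "\<forall>b\<in>{b \<in> S. t \<in> support b}. c b = 0"
      using S(1,2) by (intro generators_independent_at) auto
    then have "x (cyclic b) = y (cyclic b)" if "b \<in> S" for b
      using c[OF that] that by (cases "t \<in> support b") (auto simp: support_def)
    then have "x M = y M" for M
      using S(3) by (cases "M \<in> ?T") auto
    then show "x = y" ..
  qed
  show "(\<lambda>x. \<Sum>M | x M \<noteq> 0. x M) ` ?D = V t"
  proof
    show "(\<lambda>x. \<Sum>M | x M \<noteq> 0. x M) ` ?D \<subseteq> V t"
    proof clarify
      fix x assume x: "x \<in> ?D"
      have "x M \<in> V t" if "x M \<noteq> 0" for M
      proof -
        have M: "M \<in> cyclic ` generators" "x M \<in> M t"
          using x that unfolding direct_sum_at_def by blast+
        then show ?thesis
          using submodule_cyclic unfolding pmod_submodule_def by blast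
      qed
      then show "(\<Sum>M | x M \<noteq> 0. x M) \<in> V t"
        by (intro subspace_sum[OF subspace_V]) auto
    qed
    show "V t \<subseteq> (\<lambda>x. \<Sum>M | x M \<noteq> 0. x M) ` ?D"
    proof
      fix v assume "v \<in> V t"
      then have "v \<in> span ((\<lambda>b. b t) ` generators)"
        by (simp add: generators_span_at)
      then obtain W c where W: "finite W" "W \<subseteq> (\<lambda>b. b t) ` generators" "v = (\<Sum>w\<in>W. scale (c w) w)"
        unfolding span_explicit by blast
      then obtain S where S: "S \<subseteq> generators" "inj_on (\<lambda>b. b t) S" "W = (\<lambda>b. b t) ` S"
        unfolding subset_image_inj by blast
      have fin: "finite S"
        using W(1) S(2,3) finite_image_iff by blast
      define x where "x M = (if M \<in> cyclic ` S then scale (c (inv_into S cyclic M t)) (inv_into S cyclic M t) else 0)" for M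
      have inj: "inj_on cyclic S"
        using inj_cyclic S(1) by (rule inj_on_subset)
      have x: "x (cyclic b) = scale (c (b t)) (b t)" if "b \<in> S" for b
        using that inv_into_f_f[OF inj that] by (simp add: x_def)
      have x0: "x M = 0" if "M \<notin> cyclic ` S" for M
        using that by (simp add: x_def)
      have "x \<in> ?D"
        unfolding direct_sum_at_def
      proof (intro CollectI conjI ballI allI impI)
        fix M assume M: "M \<in> cyclic ` generators"
        show "x M \<in> M t"
        proof (cases "M \<in> cyclic ` S")
          case True
          then show ?thesis using x unfolding cyclic_def by blast
        next
          case False
          have "0 \<in> cyclic b t" for b
            unfolding cyclic_def by (rule range_eqI[of _ _ 0]) simp
          then show ?thesis using M x0[OF False] by auto
        qed
      next
        show "x M = 0" if "M \<notin> cyclic ` generators" for M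
          using x0 that S(1) by blast
        show "finite {M. x M \<noteq> 0}"
          using x0 fin by (auto intro: finite_subset[of _ "cyclic ` S"])
      qed
      moreover have "(\<Sum>M | x M \<noteq> 0. x M) = v"
      proof -
        have "(\<Sum>M | x M \<noteq> 0. x M) = (\<Sum>M\<in>cyclic ` S. x M)"
          using fin x0 by (intro sum.mono_neutral_left) auto
        also have "\<dots> = (\<Sum>b\<in>S. scale (c (b t)) (b t))"
          using x by (simp add: sum.reindex[OF inj])
        also have "\<dots> = v"
          unfolding W(3) S(3) by (simp add: sum.reindex[OF S(2)])
        finally show ?thesis .
      qed
      ultimately show "v \<in> (\<lambda>x. \<Sum>M | x M \<noteq> 0. x M) ` ?D"
        by blast
    qed
  qed
qed

lemma interval_decomposition_cyclic: "interval_decomposition scale V \<rho> (cyclic ` generators)"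
  unfolding interval_decomposition_def
  using decomposition_at submodule_cyclic cyclic_iso_interval generatorsD(1) by blast

end

lemma (in dcc_persistence_module) exists_interval_decomposition:
  assumes "\<And>I t x. \<lbrakk>order_interval I; t \<in> I; x \<in> V_plus_at V \<rho> I t\<rbrakk> \<Longrightarrow> \<exists>y\<in>V_plus V \<rho> I. y t = x"
  shows "\<exists>D. interval_decomposition scale V \<rho> D"
proof -
  obtain B where "\<And>I. nested_subspaces.basis_modulo (pointwise_scale scale)
      (V_plus V \<rho> I) (V_minus V \<rho> I) (\<lambda>b. b) (B I)"
    using nested_subspaces.exists_basis_modulo[OF nested_limits] by metis
  then interpret interval_bases scale V \<rho> B
    using assms by unfold_locales
  show ?thesis
    using interval_decomposition_cyclic by blast
qed

text \<open>A least element of \<open>I\<close> is coinitial by itself and need not belong to \<open>D\<close>, so it is added. If there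
  is no least element, the elements of \<open>D\<close> in \<open>I\<close> suffice.\<close>

lemma countable_coinitial_subset:
  fixes D I :: "'r::linorder_topology set"
  assumes D: "countable D" "closure D = UNIV" and I: "order_interval I"
  obtains C where "countable C" "C \<subseteq> I" "\<And>t. t \<in> I \<Longrightarrow> \<exists>s\<in>C. s \<le> t"
proof
  let ?C = "D \<inter> I \<union> {m \<in> I. \<forall>t\<in>I. m \<le> t}"
  have "countable {m \<in> I. \<forall>t\<in>I. m \<le> t}"
  proof (cases "\<exists>m\<in>I. \<forall>t\<in>I. m \<le> t")
    case True
    then obtain m where "m \<in> I" "\<forall>t\<in>I. m \<le> t" by blast
    then have "{m \<in> I. \<forall>t\<in>I. m \<le> t} \<subseteq> {m}" by (auto intro: antisym)
    then show ?thesis by (rule countable_subset) simp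
  next
    case False
    then have "{m \<in> I. \<forall>t\<in>I. m \<le> t} = {}" by blast
    then show ?thesis by (metis countable_empty)
  qed
  then show "countable ?C" using D(1) by auto
  show "?C \<subseteq> I" by auto
  fix t assume t: "t \<in> I"
  show "\<exists>s\<in>?C. s \<le> t"
  proof (cases "\<exists>m\<in>I. \<forall>t\<in>I. m \<le> t")
    case True
    then show ?thesis using t by blast
  next
    case False
    \<comment> \<open>Two elements below \<open>t\<close> give an open interval around one of them that lies inside \<open>I\<close>.\<close>
    then obtain s where s: "s \<in> I" "s < t" using t by (meson not_le)
    then obtain r where r: "r \<in> I" "r < s" using False by (meson not_le)
    have "s \<in> closure D" using D(2) by simp
    then obtain d where d: "d \<in> D" "d \<in> {r<..<t}"
      unfolding closure_iff_nhds_not_empty using r s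
      by (metis Int_iff ex_in_conv greaterThanLessThan_iff open_greaterThanLessThan subset_refl)
    then have "d \<in> I"
      using I r(1) t unfolding order_interval_def by (meson greaterThanLessThan_iff less_imp_le)
    then show ?thesis using d by (auto intro!: bexI[of _ d])
  qed
qed

section \<open>Counting the summands isomorphic to an interval module\<close>

locale interval_submodule = persistence_module scale V \<rho>
  for scale :: "'k::field \<Rightarrow> 'v::ab_group_add \<Rightarrow> 'v"
    and V :: "'r::linorder \<Rightarrow> 'v set" and \<rho> :: "'r \<Rightarrow> 'r \<Rightarrow> 'v \<Rightarrow> 'v" +
  fixes M :: "'r \<Rightarrow> 'v set" and J :: "'r set" and f :: "'r \<Rightarrow> 'v \<Rightarrow> 'k"
  assumes sub: "pmod_submodule scale V \<rho> M"
    and lin: "linear_between scale (M t) (*) (interval_space J t) (f t)"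
    and bij: "bij_betw (f t) (M t) (interval_space J t)"
    and comm: "s \<le> t \<Longrightarrow> x \<in> M s \<Longrightarrow> f t (\<rho> t s x) = interval_map J t s (f s x)"
begin

definition generator :: "'r \<Rightarrow> 'v" where
  "generator t = (if t \<in> J then inv_into (M t) (f t) 1 else 0)"

lemma subspace_M: "subspace (M t)" and M_subset_V: "M t \<subseteq> V t"
  and \<rho>_M: "s \<le> t \<Longrightarrow> x \<in> M s \<Longrightarrow> \<rho> t s x \<in> M t"
  using sub by (auto simp: pmod_submodule_def image_subset_iff)

lemma persistence_module_M: "persistence_module scale M \<rho>"
proof unfold_locales
  show "linear_between scale (M s) scale (M t) (\<rho> t s)" if "s \<le> t" for s t
    using that \<rho>_M \<rho>_add \<rho>_scale M_subset_V unfolding linear_between_def by blast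
  show "\<rho> t s (\<rho> s r x) = \<rho> t r x" if "r \<le> s" "s \<le> t" "x \<in> M r" for r s t x
    using that \<rho>_comp M_subset_V by blast
  show "\<rho> t t x = x" if "x \<in> M t" for t x
    using that \<rho>_id M_subset_V by blast
qed (rule subspace_M)

lemma f_inject: "x \<in> M t \<Longrightarrow> y \<in> M t \<Longrightarrow> f t x = f t y \<longleftrightarrow> x = y"
  using bij[of t] by (auto simp: bij_betw_def inj_on_def)

lemma f_scale: "x \<in> M t \<Longrightarrow> f t (scale a x) = a * f t x"
  using lin[of t] by (simp add: linear_between_def)

lemma f_zero: "f t 0 = 0"
  using f_scale[OF subspace_0[OF subspace_M], of t 0] by simp

lemma M_outside:
  assumes "t \<notin> J"
  shows "M t = {0}"
proof -
  have "f t x = 0" if "x \<in> M t" for x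
    using bij[of t] that assms by (auto simp: bij_betw_def interval_space_def)
  then show ?thesis
    using f_inject[of _ t 0] f_zero subspace_0[OF subspace_M, of t] by auto
qed

lemma f_\<rho>: "\<lbrakk>s \<le> t; s \<in> J; t \<in> J; x \<in> M s\<rbrakk> \<Longrightarrow> f t (\<rho> t s x) = f s x"
  by (simp add: comm interval_map_def)

lemma \<rho>_eq_0D:
  assumes "s \<le> t" "s \<in> J" "t \<in> J" "x \<in> M s" "\<rho> t s x = 0"
  shows "x = 0"
  using f_\<rho>[OF assms(1-4)] f_inject[OF assms(4) subspace_0[OF subspace_M]] assms(5) by (simp add: f_zero)

lemma generator:
  assumes "t \<in> J"
  shows "generator t \<in> M t" "f t (generator t) = 1"
  using assms bij[of t] unfolding generator_def bij_betw_def interval_space_def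
  by (auto simp: inv_into_into f_inv_into_f)

lemma generator_nonzero: "t \<in> J \<Longrightarrow> generator t \<noteq> 0"
  using generator(2) f_zero by fastforce

lemma \<rho>_generator: "\<lbrakk>s \<le> t; s \<in> J; t \<in> J\<rbrakk> \<Longrightarrow> \<rho> t s (generator s) = generator t"
  using f_inject[OF \<rho>_M generator(1), of s t "generator s"] f_\<rho> generator by simp

lemma M_eq_scale_generator:
  assumes "t \<in> J" "x \<in> M t"
  shows "x = scale (f t x) (generator t)"
proof -
  have "f t x = f t (scale (f t x) (generator t))"
    using generator[OF assms(1)] f_scale by simp
  then show ?thesis
    using f_inject[OF assms(2) subspace_scale[OF subspace_M generator(1)[OF assms(1)]]] by blast
qed

lemma Im_M:
  assumes "s \<le> t" "s \<in> J" "t \<in> J"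
  shows "Im M \<rho> t s = M t"
proof
  show "Im M \<rho> t s \<subseteq> M t"
    using \<rho>_M[OF assms(1)] by (auto simp: Im_def)
  show "M t \<subseteq> Im M \<rho> t s"
  proof
    fix x assume "x \<in> M t"
    then have "x = scale (f t x) (\<rho> t s (generator s))"
      unfolding \<rho>_generator[OF assms] by (rule M_eq_scale_generator[OF assms(3)])
    also have "\<dots> = \<rho> t s (scale (f t x) (generator s))"
      using generator(1)[OF assms(2)] M_subset_V by (intro \<rho>_scale[OF assms(1), symmetric]) auto
    finally have "x = \<rho> t s (scale (f t x) (generator s))" .
    then show "x \<in> Im M \<rho> t s"
      unfolding Im_def using subspace_scale[OF subspace_M generator(1)[OF assms(2)]] by blast
  qed
qed

lemma Im_outside: "s \<le> t \<Longrightarrow> s \<notin> J \<Longrightarrow> Im M \<rho> t s = {0}"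
  by (simp add: Im_def M_outside \<rho>_zero)

lemma Ker_M: "t \<le> r \<Longrightarrow> t \<in> J \<Longrightarrow> r \<in> J \<Longrightarrow> Ker M \<rho> r t = {0}"
  using \<rho>_eq_0D subspace_0[OF subspace_M] \<rho>_zero by (auto simp: Ker_def)

lemma Ker_outside: "t \<le> r \<Longrightarrow> r \<notin> J \<Longrightarrow> Ker M \<rho> r t = M t"
  using \<rho>_M[of t r] M_outside[of r] by (auto simp: Ker_def)

text \<open>A nonzero vector of \<open>V_plus_at\<close> forces \<open>J\<close> to agree with \<open>I\<close> below \<open>t\<close> inside \<open>I\<close> and to
  avoid everything above \<open>I\<close>. So \<open>J\<close> differs from \<open>I\<close> by starting earlier, which puts the vector
  into the image part of \<open>V_minus_at\<close>, or by ending earlier, which puts it into the kernel part.\<close>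

lemma V_plus_at_other_interval:
  assumes I: "order_interval I" and t: "t \<in> I" and "J \<noteq> I"
  shows "V_plus_at M \<rho> I t \<subseteq> V_minus_at M \<rho> I t"
proof
  interpret N: persistence_module scale M \<rho> by (rule persistence_module_M)
  let ?l = "lower_cut I" and ?u = "upper_cut I"
  have l: "is_cut ?l" "t \<in> snd ?l" and u: "is_cut ?u" "t \<in> fst ?u"
    using is_cut_lower_cut is_cut_upper_cut mem_cuts[OF t] by auto
  fix x assume "x \<in> V_plus_at M \<rho> I t"
  then have im: "\<And>s. s \<in> snd ?l \<Longrightarrow> s \<le> t \<Longrightarrow> x \<in> Im M \<rho> t s" and ker: "x \<in> Ker_plus M \<rho> ?u t"
    by (auto simp: V_plus_at_def Im_plus_def)
  have imP: "x \<in> Im_plus M \<rho> ?l t"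
    using im by (simp add: Im_plus_def)
  have xM: "x \<in> M t"
    using im[OF l(2)] \<rho>_M[of t t] by (auto simp: Im_def)
  have 0: "0 \<in> Im_minus M \<rho> ?l t" "0 \<in> Im_plus M \<rho> ?l t" "0 \<in> Ker_minus M \<rho> ?u t" "0 \<in> Ker_plus M \<rho> ?u t"
    using subspace_0 N.subspace_Im_minus[OF l] N.subspace_Im_plus N.subspace_Ker_minus[OF u(2)]
      N.subspace_Ker_plus[OF u] by auto
  show "x \<in> V_minus_at M \<rho> I t"
  proof (cases "x = 0")
    case True
    then show ?thesis using subspace_0[OF N.subspace_V_minus_at[OF t]] by simp
  next
    case False
    have tJ: "t \<in> J"
      using M_outside xM False by blast
    have below: "s \<in> J" if "s \<in> snd ?l" "s \<le> t" for s
      using im[OF that] Im_outside[OF that(2)] False by blast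
    have above: "r \<notin> J" if "r \<in> snd ?u" for r
    proof
      assume "r \<in> J"
      moreover have "t \<le> r" using u that unfolding is_cut_def by (auto simp: less_imp_le)
      moreover have "x \<in> Ker M \<rho> r t" using ker that by (auto simp: Ker_plus_def split: if_splits)
      ultimately show False using Ker_M[of t r] tJ False by simp
    qed
    consider s where "s \<in> J" "s \<notin> I" | s where "s \<in> I" "s \<notin> J"
      using \<open>J \<noteq> I\<close> by blast
    then show ?thesis
    proof cases
      case 1
      then have "s \<in> fst ?l"
        using above[of s] interval_eq_cuts[OF I] l(1) u(1) unfolding is_cut_def by blast
      then have "x \<in> Im_minus M \<rho> ?l t"
        using Im_M[of s t] 1 tJ xM l unfolding is_cut_def Im_minus_def by (auto simp: less_imp_le)
      then have "x + 0 \<in> V_minus_at M \<rho> I t"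
        unfolding V_minus_at_def using ker 0 by blast
      then show ?thesis by simp
    next
      case 2
      then have "t \<le> s" "s \<in> fst ?u"
        using below[of s] mem_cuts[of s I] by (meson linear)+
      then have "x \<in> Ker_minus M \<rho> ?u t"
        using Ker_outside[of t s] 2 xM unfolding Ker_minus_def by blast
      then have "0 + x \<in> V_minus_at M \<rho> I t"
        unfolding V_minus_at_def using 0 imP by blast
      then show ?thesis by simp
    qed
  qed
qed

text \<open>A copy of the interval module of \<open>J\<close> has nothing before \<open>J\<close> that could map into \<open>M t\<close>, and its
  maps within \<open>J\<close> are injective; so both parts of \<open>V_minus_at\<close> vanish. In the same way
  \<open>V_plus_at\<close> is everything, because the maps within \<open>J\<close> are surjective and \<open>M\<close> is zero after \<open>J\<close>.\<close>

lemma V_minus_at_same_interval: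
  assumes J: "order_interval J" and t: "t \<in> J"
  shows "V_minus_at M \<rho> J t \<subseteq> {0}"
proof -
  let ?l = "lower_cut J" and ?u = "upper_cut J"
  have l: "is_cut ?l" "t \<in> snd ?l" and u: "is_cut ?u" "t \<in> fst ?u"
    using is_cut_lower_cut is_cut_upper_cut mem_cuts[OF t] by auto
  have "Im M \<rho> t s = {0}" if "s \<in> fst ?l" for s
  proof (rule Im_outside)
    show "s \<le> t" using that l unfolding is_cut_def by (auto simp: less_imp_le)
    show "s \<notin> J" using that by (auto simp: lower_cut_def)
  qed
  then have "Im_minus M \<rho> ?l t \<subseteq> {0}"
    by (auto simp: Im_minus_def)
  moreover have "Ker M \<rho> r t = {0}" if "r \<in> fst ?u" "t \<le> r" for r
  proof (rule Ker_M[OF that(2) t])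
    show "r \<in> J" using that t J unfolding order_interval_def upper_cut_def fst_conv by blast
  qed
  then have "Ker_minus M \<rho> ?u t \<subseteq> {0}"
    by (auto simp: Ker_minus_def)
  ultimately show ?thesis
    unfolding V_minus_at_def by (fastforce elim!: set_plus_elim)
qed

lemma V_plus_at_same_interval:
  assumes J: "order_interval J" and t: "t \<in> J"
  shows "M t \<subseteq> V_plus_at M \<rho> J t"
proof -
  let ?l = "lower_cut J" and ?u = "upper_cut J"
  have "Im M \<rho> t s = M t" if "s \<in> snd ?l" "s \<le> t" for s
  proof (rule Im_M[OF that(2) _ t])
    show "s \<in> J" using that t J unfolding order_interval_def lower_cut_def snd_conv by blast
  qed
  then have "M t \<subseteq> Im_plus M \<rho> ?l t"
    by (auto simp: Im_plus_def)
  moreover have "Ker M \<rho> r t = M t" if "r \<in> snd ?u" for r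
    using that t by (intro Ker_outside) (auto simp: upper_cut_def less_imp_le)
  then have "M t \<subseteq> Ker_plus M \<rho> ?u t"
    by (simp add: Ker_plus_def)
  ultimately show ?thesis
    by (simp add: V_plus_at_def)
qed

lemma Im_Ker_mono:
  shows "Im_minus M \<rho> c t \<subseteq> Im_minus V \<rho> c t" "Im_plus M \<rho> c t \<subseteq> Im_plus V \<rho> c t"
    "Ker_minus M \<rho> c t \<subseteq> Ker_minus V \<rho> c t" "Ker_plus M \<rho> c t \<subseteq> Ker_plus V \<rho> c t"
proof -
  have *: "Im M \<rho> t s \<subseteq> Im V \<rho> t s" "Ker M \<rho> s t \<subseteq> Ker V \<rho> s t" for s
    using M_subset_V by (auto simp: Im_def Ker_def)
  show "Im_minus M \<rho> c t \<subseteq> Im_minus V \<rho> c t" "Im_plus M \<rho> c t \<subseteq> Im_plus V \<rho> c t"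
    "Ker_minus M \<rho> c t \<subseteq> Ker_minus V \<rho> c t"
    unfolding Im_minus_def Im_plus_def Ker_minus_def by (auto dest!: subsetD[OF *(1)] subsetD[OF *(2)])
  show "Ker_plus M \<rho> c t \<subseteq> Ker_plus V \<rho> c t"
    unfolding Ker_plus_def using M_subset_V[of t] by (auto dest!: subsetD[OF *(2)])
qed

lemma V_plus_at_mono: "V_plus_at M \<rho> I t \<subseteq> V_plus_at V \<rho> I t"
  unfolding V_plus_at_def by (intro Int_mono Im_Ker_mono)

lemma V_minus_at_mono: "V_minus_at M \<rho> I t \<subseteq> V_minus_at V \<rho> I t"
  unfolding V_minus_at_def by (intro set_plus_mono2 Int_mono Im_Ker_mono)

lemma generator_in_V_plus:
  assumes "order_interval J"
  shows "generator \<in> V_plus V \<rho> J"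
  using V_plus_at_same_interval[OF assms] V_plus_at_mono generator(1) \<rho>_generator
  by (auto simp: V_plus_def inverse_limit_def generator_def[of t for t]) blast+

end

lemma (in persistence_module) interval_submoduleE:
  assumes "pmod_submodule scale V \<rho> M" "iso_interval_module scale M \<rho> J"
  obtains f where "interval_submodule scale V \<rho> M J f"
proof -
  obtain f where "\<forall>t. linear_between scale (M t) (*) (interval_space J t) (f t) \<and>
        bij_betw (f t) (M t) (interval_space J t)"
      "\<forall>s t. s \<le> t \<longrightarrow> (\<forall>x\<in>M s. f t (\<rho> t s x) = interval_map J t s (f s x))"
    using assms(2) unfolding iso_interval_module_def pmod_iso_def by blast
  with assms(1) have "interval_submodule scale V \<rho> M J f"
    by unfold_locales auto
  then show thesis by (rule that)
qed

locale interval_decomposed = dcc_persistence_module scale V \<rho>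
  for scale :: "'k::field \<Rightarrow> 'v::ab_group_add \<Rightarrow> 'v"
    and V :: "'r::linorder \<Rightarrow> 'v set" and \<rho> :: "'r \<Rightarrow> 'r \<Rightarrow> 'v \<Rightarrow> 'v" +
  fixes D :: "('r \<Rightarrow> 'v set) set"
  assumes decomposition: "interval_decomposition scale V \<rho> D"
begin

definition component :: "'r \<Rightarrow> 'v \<Rightarrow> ('r \<Rightarrow> 'v set) \<Rightarrow> 'v" where
  "component t = inv_into (direct_sum_at D t) (\<lambda>x. \<Sum>M | x M \<noteq> 0. x M)"

lemma submodule: "M \<in> D \<Longrightarrow> pmod_submodule scale V \<rho> M"
  and summand_is_interval: "M \<in> D \<Longrightarrow> \<exists>J. order_interval J \<and> iso_interval_module scale M \<rho> J"
  and sum_bij: "bij_betw (\<lambda>x. \<Sum>M | x M \<noteq> 0. x M) (direct_sum_at D t) (V t)"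
  using decomposition unfolding interval_decomposition_def by blast+

lemma subspace_summand: "M \<in> D \<Longrightarrow> subspace (M t)"
  using submodule unfolding pmod_submodule_def by blast

lemma component_in: "x \<in> V t \<Longrightarrow> component t x \<in> direct_sum_at D t"
  unfolding component_def using sum_bij[of t] by (auto simp: bij_betw_def intro: inv_into_into)

lemma sum_component: "x \<in> V t \<Longrightarrow> (\<Sum>M | component t x M \<noteq> 0. component t x M) = x"
  unfolding component_def using bij_betw_inv_into_right[OF sum_bij[of t]] .

lemma component_unique:
  assumes "\<And>M. M \<in> D \<Longrightarrow> y M \<in> M t" "\<And>M. M \<notin> T \<Longrightarrow> y M = 0" "finite T" "T \<subseteq> D" "(\<Sum>M\<in>T. y M) = x"
  shows "component t x = y"
proof -
  have y: "y \<in> direct_sum_at D t"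
    using assms unfolding direct_sum_at_def by (auto intro: finite_subset[of _ T])
  have "(\<Sum>M | y M \<noteq> 0. y M) = (\<Sum>M\<in>T. y M)"
    using assms(2,3) by (intro sum.mono_neutral_left) auto
  then have "component t x = component t (\<Sum>M | y M \<noteq> 0. y M)"
    using assms(5) by simp
  also have "\<dots> = y"
    unfolding component_def using sum_bij[of t] y by (intro inv_into_f_f) (auto simp: bij_betw_def)
  finally show ?thesis .
qed

lemma component_summand: "x \<in> V t \<Longrightarrow> M \<in> D \<Longrightarrow> component t x M \<in> M t"
  and component_outside: "x \<in> V t \<Longrightarrow> M \<notin> D \<Longrightarrow> component t x M = 0"
  and finite_component: "x \<in> V t \<Longrightarrow> finite {M. component t x M \<noteq> 0}"
  using component_in[of x t] by (auto simp: direct_sum_at_def)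

lemma support_component: "x \<in> V t \<Longrightarrow> {M. component t x M \<noteq> 0} \<subseteq> D"
  using component_outside by blast

lemma component_zero: "component t 0 M = 0"
proof -
  have "component t 0 = (\<lambda>_. 0)"
    by (rule component_unique[where T = "{}"]) (simp_all add: subspace_0[OF subspace_summand])
  then show ?thesis by simp
qed

lemma component_add:
  assumes x: "x \<in> V t" and y: "y \<in> V t"
  shows "component t (x + y) M = component t x M + component t y M"
proof -
  let ?X = "{M. component t x M \<noteq> 0}" and ?Y = "{M. component t y M \<noteq> 0}"
  have fin: "finite (?X \<union> ?Y)" using finite_component x y by blast
  have "component t (x + y) = (\<lambda>M. component t x M + component t y M)"
  proof (rule component_unique[where T = "?X \<union> ?Y"])
    have "(\<Sum>M\<in>?X \<union> ?Y. component t x M) = (\<Sum>M\<in>?X. component t x M)"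
        "(\<Sum>M\<in>?X \<union> ?Y. component t y M) = (\<Sum>M\<in>?Y. component t y M)"
      using fin by (intro sum.mono_neutral_right; blast)+
    then show "(\<Sum>M\<in>?X \<union> ?Y. component t x M + component t y M) = x + y"
      by (simp add: sum.distrib sum_component x y)
  qed (use fin support_component x y component_summand subspace_add[OF subspace_summand] in auto)
  then show ?thesis by simp
qed

text \<open>The components of the image are the images of the components, since the latter lie in the
  summands and have the right sum. Hence taking components respects all spaces defined by images
  and kernels.\<close>

lemma component_\<rho>:
  assumes st: "s \<le> t" and x: "x \<in> V s"
  shows "component t (\<rho> t s x) M = \<rho> t s (component s x M)"
proof -
  have V: "component s x M \<in> V s" if "M \<in> D" for M
    using component_summand[OF x that] submodule[OF that] unfolding pmod_submodule_def by blast
  have "component t (\<rho> t s x) = (\<lambda>M. \<rho> t s (component s x M))"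
  proof (rule component_unique[where T = "{M. component s x M \<noteq> 0}"])
    show "\<rho> t s (component s x M) \<in> M t" if "M \<in> D" for M
      using component_summand[OF x that] submodule[OF that] st unfolding pmod_submodule_def by blast
    have "\<rho> t s (\<Sum>M | component s x M \<noteq> 0. component s x M) = (\<Sum>M | component s x M \<noteq> 0. \<rho> t s (component s x M))"
      using V support_component[OF x] by (intro \<rho>_sum[OF st]) auto
    then show "(\<Sum>M | component s x M \<noteq> 0. \<rho> t s (component s x M)) = \<rho> t s x"
      by (simp add: sum_component[OF x])
  qed (use finite_component[OF x] support_component[OF x] \<rho>_zero[OF st] in auto)
  then show ?thesis by simp
qed

lemma component_Im:
  assumes "M \<in> D" "s \<le> t" "x \<in> Im V \<rho> t s"
  shows "component t x M \<in> Im M \<rho> t s"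
  using assms component_\<rho>[OF assms(2)] component_summand unfolding Im_def by auto

lemma component_Ker:
  assumes "M \<in> D" "t \<le> r" "x \<in> Ker V \<rho> r t"
  shows "component t x M \<in> Ker M \<rho> r t"
  using assms component_\<rho>[OF assms(2), of x M] component_summand component_zero unfolding Ker_def by auto

lemma component_Im_plus: "\<lbrakk>M \<in> D; x \<in> Im_plus V \<rho> c t\<rbrakk> \<Longrightarrow> component t x M \<in> Im_plus M \<rho> c t"
  using component_Im unfolding Im_plus_def by blast

lemma component_Im_minus:
  assumes M: "M \<in> D" and c: "is_cut c" "t \<in> snd c" and x: "x \<in> Im_minus V \<rho> c t"
  shows "component t x M \<in> Im_minus M \<rho> c t"
proof (cases "fst c = {}")
  case True
  then show ?thesis using x component_zero by (simp add: Im_minus_def)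
next
  case False
  then obtain s where "s \<in> fst c" "x \<in> Im V \<rho> t s"
    using x by (auto simp: Im_minus_def)
  moreover from this have "s \<le> t"
    using c unfolding is_cut_def by (auto simp: less_imp_le)
  ultimately show ?thesis
    using component_Im[OF M] False by (auto simp: Im_minus_def)
qed

lemma component_Ker_minus: "\<lbrakk>M \<in> D; x \<in> Ker_minus V \<rho> c t\<rbrakk> \<Longrightarrow> component t x M \<in> Ker_minus M \<rho> c t"
  using component_Ker unfolding Ker_minus_def by blast

lemma component_Ker_plus:
  assumes M: "M \<in> D" and c: "is_cut c" "t \<in> fst c" and x: "x \<in> Ker_plus V \<rho> c t"
  shows "component t x M \<in> Ker_plus M \<rho> c t"
proof (cases "snd c = {}")
  case True
  then show ?thesis using x component_summand[OF _ M] by (simp add: Ker_plus_def)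
next
  case False
  have "t \<le> r" if "r \<in> snd c" for r
    using that c unfolding is_cut_def by (auto simp: less_imp_le)
  then show ?thesis
    using x False component_Ker[OF M] by (auto simp: Ker_plus_def)
qed

lemma component_V_plus_at:
  assumes "M \<in> D" "t \<in> I" "x \<in> V_plus_at V \<rho> I t"
  shows "component t x M \<in> V_plus_at M \<rho> I t"
  using assms component_Im_plus component_Ker_plus[OF _ is_cut_upper_cut mem_cuts(2)]
  by (simp add: V_plus_at_def)

lemma component_V_minus_at:
  assumes M: "M \<in> D" and t: "t \<in> I" and x: "x \<in> V_minus_at V \<rho> I t"
  shows "component t x M \<in> V_minus_at M \<rho> I t"
proof -
  let ?l = "lower_cut I" and ?u = "upper_cut I"
  obtain a b where ab: "x = a + b" "a \<in> Im_minus V \<rho> ?l t \<inter> Ker_plus V \<rho> ?u t"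
      "b \<in> Im_plus V \<rho> ?l t \<inter> Ker_minus V \<rho> ?u t"
    using x unfolding V_minus_at_def by (auto elim!: set_plus_elim)
  have "a \<in> V t" "b \<in> V t"
    using ab Im_minus_subset_Im_plus[OF is_cut_lower_cut mem_cuts(1)[OF t]] Im_plus_subset_V[OF mem_cuts(1)[OF t]]
    by auto
  then have "component t x M = component t a M + component t b M"
    by (simp add: ab(1) component_add)
  moreover have "component t a M \<in> Im_minus M \<rho> ?l t \<inter> Ker_plus M \<rho> ?u t"
    using ab(2) component_Im_minus[OF M is_cut_lower_cut mem_cuts(1)[OF t]]
      component_Ker_plus[OF M is_cut_upper_cut mem_cuts(2)[OF t]] by blast
  moreover have "component t b M \<in> Im_plus M \<rho> ?l t \<inter> Ker_minus M \<rho> ?u t"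
    using ab(3) component_Im_plus[OF M] component_Ker_minus[OF M] by blast
  ultimately show ?thesis
    unfolding V_minus_at_def by (simp add: set_plus_intro)
qed

text \<open>Everything can be read off at a single \<open>t\<close> in \<open>I\<close>: the component in a summand of another
  type lies in \<open>V_minus_at\<close>, while in a copy of the interval module of \<open>I\<close> it is a multiple of the
  generator and lies in \<open>V_minus_at\<close> only if it is zero.\<close>

lemma card_summands:
  assumes I: "order_interval I"
  shows "|{M \<in> D. iso_interval_module scale M \<rho> I}|
           =o quotient_dim (pointwise_scale scale) (V_plus V \<rho> I) (V_minus V \<rho> I)"
proof -
  interpret lim: nested_subspaces "pointwise_scale scale :: 'k \<Rightarrow> ('r \<Rightarrow> 'v) \<Rightarrow> 'r \<Rightarrow> 'v"
    "V_plus V \<rho> I" "V_minus V \<rho> I"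
    by (rule nested_limits)
  let ?A = "{M \<in> D. iso_interval_module scale M \<rho> I}"
  have "\<exists>f. interval_submodule scale V \<rho> M I f" if "M \<in> ?A" for M
    using interval_submoduleE[of M I] submodule that by blast
  then have "\<exists>f. \<forall>M\<in>?A. interval_submodule scale V \<rho> M I (f M)"
    by (intro bchoice) blast
  then obtain f where f: "\<And>M. M \<in> ?A \<Longrightarrow> interval_submodule scale V \<rho> M I (f M)"
    by blast
  define g where "g M = interval_submodule.generator M I (f M)" for M
  obtain t where t: "t \<in> I"
    using I by (auto simp: order_interval_def)
  have g_plus: "g M \<in> V_plus V \<rho> I" if "M \<in> ?A" for M
    unfolding g_def using interval_submodule.generator_in_V_plus[OF f[OF that] I] .
  have g_M: "g M t \<in> M t" "g M t \<noteq> 0" if "M \<in> ?A" for M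
    unfolding g_def using interval_submodule.generator(1)[OF f[OF that] t]
      interval_submodule.generator_nonzero[OF f[OF that] t] by auto
  have "lim.basis_modulo g ?A"
    unfolding lim.basis_modulo_def
  proof (intro conjI allI impI ballI)
    show "g ` ?A \<subseteq> V_plus V \<rho> I" using g_plus by blast
  next
    fix S c M assume S: "finite S" "S \<subseteq> ?A"
      "(\<Sum>M\<in>S. pointwise_scale scale (c M) (g M)) \<in> V_minus V \<rho> I" "M \<in> S"
    let ?x = "\<Sum>M\<in>S. scale (c M) (g M t)"
    have "?x \<in> V_minus_at V \<rho> I t"
      using S(3) t by (auto simp: V_minus_def sum_pointwise_scale_apply)
    then have "component t ?x M \<in> V_minus_at M \<rho> I t"
      using component_V_minus_at[OF _ t] S(2,4) by blast
    moreover have "V_minus_at M \<rho> I t \<subseteq> {0}"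
      using interval_submodule.V_minus_at_same_interval[OF f I t] S(2,4) by blast
    moreover have "component t ?x = (\<lambda>M. if M \<in> S then scale (c M) (g M t) else 0)"
    proof (rule component_unique[where T = S])
      show "(if M \<in> S then scale (c M) (g M t) else 0) \<in> M t" if "M \<in> D" for M
        using g_M(1) S(2) that subspace_scale[OF subspace_summand] subspace_0[OF subspace_summand] by auto
    qed (use S(1,2) in auto)
    ultimately have "scale (c M) (g M t) = 0"
      using S(4) by auto
    then show "c M = 0"
      using g_M(2) S(2,4) by auto
  next
    fix x assume x: "x \<in> V_plus V \<rho> I"
    let ?y = "component t (x t)"
    have xt: "x t \<in> V_plus_at V \<rho> I t" "x t \<in> V t"
      using V_plusD(1)[OF x t] V_plus_at_subset_V[OF t] by auto
    let ?T = "{M. ?y M \<noteq> 0}"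
    have T: "finite ?T" "?T \<subseteq> D"
      using finite_component[OF xt(2)] support_component[OF xt(2)] by auto
    let ?S = "?T \<inter> ?A"
    (* The isomorphism with the interval module reads off the coordinate with respect to the
       generator. *)
    let ?c = "\<lambda>M. f M t (?y M)"
    have on_S: "scale (?c M) (g M t) = ?y M" if "M \<in> ?S" for M
      unfolding g_def using that
      by (intro interval_submodule.M_eq_scale_generator[OF f t component_summand[OF xt(2)], symmetric]) auto
    let ?z = "x - (\<Sum>M\<in>?S. pointwise_scale scale (?c M) (g M))"
    have "?z t = (\<Sum>M\<in>?T. ?y M) - (\<Sum>M\<in>?S. ?y M)"
      using sum_component[OF xt(2)] on_S by (simp add: sum_pointwise_scale_apply)
    also have "\<dots> = (\<Sum>M\<in>?T - ?S. ?y M)"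
      using T(1) by (simp add: sum_diff)
    also have "\<dots> \<in> V_minus_at V \<rho> I t"
    proof (rule subspace_sum[OF subspace_V_minus_at[OF t]])
      fix M assume M: "M \<in> ?T - ?S"
      then have MD: "M \<in> D" using T(2) by blast
      then obtain J where J: "order_interval J" "iso_interval_module scale M \<rho> J"
        using summand_is_interval by blast
      obtain h where h: "interval_submodule scale V \<rho> M J h"
        using interval_submoduleE[OF submodule[OF MD] J(2)] .
      have "J \<noteq> I" using M MD J(2) by auto
      then show "?y M \<in> V_minus_at V \<rho> I t"
        using component_V_plus_at[OF MD t xt(1)] interval_submodule.V_plus_at_other_interval[OF h I t]
          interval_submodule.V_minus_at_mono[OF h] by blast
    qed
    finally have "?z t \<in> V_minus_at V \<rho> I t" .
    moreover have "?z \<in> V_plus V \<rho> I"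
      using g_plus by (intro families.subspace_diff[OF lim.U x] families.subspace_sum[OF lim.U]
          families.subspace_scale[OF lim.U]) auto
    ultimately have "?z \<in> V_minus V \<rho> I"
      using V_minus_iff[OF _ t] by blast
    then show "\<exists>S c. finite S \<and> S \<subseteq> ?A \<and> x - (\<Sum>M\<in>S. pointwise_scale scale (c M) (g M)) \<in> V_minus V \<rho> I"
      using T(1) by (intro exI[of _ ?S] exI[of _ ?c]) auto
  qed
  then show ?thesis
    by (rule lim.quotient_dim_eq_card)
qed

end

theorem corollary7p2:
  fixes scl :: "'k::field \<Rightarrow> 'v::ab_group_add \<Rightarrow> 'v"
    and V :: "'r::linorder_topology \<Rightarrow> 'v set"
    and \<rho> :: "'r \<Rightarrow> 'r \<Rightarrow> 'v \<Rightarrow> 'v"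
    and I :: "'r set"
  assumes "\<exists>D :: 'r set. countable D \<and> closure D = UNIV"
    and "persistence_module scl V \<rho>"
    and "dcc_images_kernels V \<rho>"
    and "order_interval I"
  shows "has_multiplicity scl V \<rho> I
           (quotient_dim (pointwise_scale scl) (V_plus V \<rho> I) (V_minus V \<rho> I))"
proof -
  interpret dcc_persistence_module scl V \<rho>
    using assms(2,3) by (simp add: dcc_persistence_module_def dcc_persistence_module_axioms_def)
  obtain E :: "'r set" where E: "countable E" "closure E = UNIV"
    using assms(1) by blast
  have "\<exists>D. interval_decomposition scl V \<rho> D"
  proof (rule exists_interval_decomposition)
    fix J t x assume J: "order_interval J" "t \<in> J" "x \<in> V_plus_at V \<rho> J t"
    obtain C where "countable C" "C \<subseteq> J" "\<And>t. t \<in> J \<Longrightarrow> \<exists>s\<in>C. s \<le> t"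
      using countable_coinitial_subset[OF E J(1)] by blast
    then show "\<exists>y\<in>V_plus V \<rho> J. y t = x"
      using V_plus_lift J(2,3) by blast
  qed
  moreover have "|{M \<in> D. iso_interval_module scl M \<rho> I}|
      =o quotient_dim (pointwise_scale scl) (V_plus V \<rho> I) (V_minus V \<rho> I)"
    if "interval_decomposition scl V \<rho> D" for D
  proof -
    interpret interval_decomposed scl V \<rho> D
      using that by unfold_locales
    show ?thesis
      by (rule card_summands[OF assms(4)])
  qed
  ultimately show ?thesis
    unfolding has_multiplicity_def by blast
qed

end
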